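(* Let $H$ be a complex separable Hilbert space and let $A,B,X$ be bounded linear operators on $H$ such that $A$ and $B$ are compact. Then $$s_{j}(AXB^{*})\leq \|X\|\,s_{j}^{2}(A\oplus B)$$ for all $j=1,2,\ldots$.
   Context: $\|\cdot\|$ is the operator norm. $A\oplus B$ denotes the block diagonal operator $\begin{bmatrix} A&0\\0&B\end{bmatrix}$ on $H\oplus H$. For a compact operator $T$, $s_{1}(T)\geq s_{2}(T)\geq\cdots$ are the singular values of $T$, i.e. the eigenvalues of $|T|=(T^{*}T)^{1/2}$ in decreasing order repeated according to multiplicity (extended by zeros if necessary), and $s_{j}^{2}(T)=(s_{j}(T))^{2}$. *)

theory Defs
  imports "HOL-Analysis.Analysis"
begin

section \<open>Complex Hilbert spaces\<close>

text \<open>The norm and topology come from \<^class>\<open>real_normed_vector\<close>; the axioms say that the real scalar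
  multiplication is the restriction of the complex one, and that the norm is the one induced by
  the inner product, which is linear in its first argument. Positive definiteness of the inner
  product is contained in \<open>cinner_self\<close>.\<close>

class complex_inner = real_normed_vector +
  fixes scaleC :: "complex \<Rightarrow> 'a \<Rightarrow> 'a"  (infixr \<open>*\<^sub>C\<close> 75)
    and cinner :: "'a \<Rightarrow> 'a \<Rightarrow> complex"
  assumes scaleC_add_right: "a *\<^sub>C (x + y) = a *\<^sub>C x + a *\<^sub>C y"
    and scaleC_add_left: "(a + b) *\<^sub>C x = a *\<^sub>C x + b *\<^sub>C x"
    and scaleC_scaleC: "a *\<^sub>C (b *\<^sub>C x) = (a * b) *\<^sub>C x"
    and scaleC_one: "1 *\<^sub>C x = x"
    and scaleR_eq_scaleC: "r *\<^sub>R x = complex_of_real r *\<^sub>C x"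
    and cinner_commute: "cinner x y = cnj (cinner y x)"
    and cinner_add_left: "cinner (x + y) z = cinner x z + cinner y z"
    and cinner_scaleC_left: "cinner (a *\<^sub>C x) y = a * cinner x y"
    and cinner_self: "cinner x x = complex_of_real ((norm x)\<^sup>2)"

class complex_hilbert = complex_inner + banach

global_interpretation complex_vector:
  vector_space "scaleC :: complex \<Rightarrow> 'a \<Rightarrow> 'a::complex_inner"
  by unfold_locales (simp_all add: scaleC_add_right scaleC_add_left scaleC_scaleC scaleC_one)

text \<open>The Hilbert space direct sum \<open>H \<oplus> H\<close> is the product type with its library norm
  \<open>sqrt ((norm x)\<^sup>2 + (norm y)\<^sup>2)\<close>; the block diagonal operator \<open>A \<oplus> B\<close> is \<^term>\<open>map_prod A B\<close>.\<close>

instantiation prod :: (complex_inner, complex_inner) complex_inner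
begin

definition scaleC_prod_def: "c *\<^sub>C p = (c *\<^sub>C fst p, c *\<^sub>C snd p)"

definition cinner_prod_def: "cinner p q = cinner (fst p) (fst q) + cinner (snd p) (snd q)"

instance
proof
  fix a b :: complex and r :: real and x y z :: "'a \<times> 'b"
  show "a *\<^sub>C (x + y) = a *\<^sub>C x + a *\<^sub>C y"
    by (simp add: scaleC_prod_def scaleC_add_right)
  show "(a + b) *\<^sub>C x = a *\<^sub>C x + b *\<^sub>C x"
    by (simp add: scaleC_prod_def scaleC_add_left)
  show "a *\<^sub>C (b *\<^sub>C x) = (a * b) *\<^sub>C x"
    by (simp add: scaleC_prod_def scaleC_scaleC)
  show "1 *\<^sub>C x = x"
    by (simp add: scaleC_prod_def scaleC_one)
  show "r *\<^sub>R x = complex_of_real r *\<^sub>C x"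
    by (simp add: scaleC_prod_def scaleR_prod_def scaleR_eq_scaleC)
  show "cinner x y = cnj (cinner y x)"
    unfolding cinner_prod_def complex_cnj_add
    by (metis cinner_commute)
  show "cinner (x + y) z = cinner x z + cinner y z"
    by (simp add: cinner_prod_def cinner_add_left)
  show "cinner (a *\<^sub>C x) y = a * cinner x y"
    by (simp add: cinner_prod_def scaleC_prod_def cinner_scaleC_left distrib_left)
  show "cinner x x = complex_of_real ((norm x)\<^sup>2)"
    by (simp add: cinner_prod_def cinner_self norm_prod_def)
qed

end

instance prod :: (complex_hilbert, complex_hilbert) complex_hilbert ..

section \<open>Operators\<close>

definition bounded_clinear :: "('a::complex_inner \<Rightarrow> 'b::complex_inner) \<Rightarrow> bool" where
  "bounded_clinear T \<longleftrightarrow> bounded_linear T \<and> (\<forall>c x. T (c *\<^sub>C x) = c *\<^sub>C T x)"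

definition compact_operator :: "('a::complex_inner \<Rightarrow> 'b::complex_inner) \<Rightarrow> bool" where
  "compact_operator T \<longleftrightarrow> bounded_clinear T \<and> compact (closure (T ` cball 0 1))"

definition cadjoint :: "('a::complex_inner \<Rightarrow> 'b::complex_inner) \<Rightarrow> 'b \<Rightarrow> 'a" where
  "cadjoint T = (THE S. \<forall>x y. cinner (T x) y = cinner x (S y))"

definition positive_operator :: "('a::complex_inner \<Rightarrow> 'a) \<Rightarrow> bool" where
  "positive_operator P \<longleftrightarrow> bounded_clinear P \<and> (\<forall>x. cinner (P x) x \<in> \<real>\<^sub>\<ge>\<^sub>0)"

definition abs_operator :: "('a::complex_inner \<Rightarrow> 'a) \<Rightarrow> 'a \<Rightarrow> 'a" where
  "abs_operator T = (THE P. positive_operator P \<and> P \<circ> P = cadjoint T \<circ> T)"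

definition eigenspace :: "('a::complex_inner \<Rightarrow> 'a) \<Rightarrow> complex \<Rightarrow> 'a set" where
  "eigenspace T a = {x. T x = a *\<^sub>C x}"

text \<open>The eigenvalues of the absolute value of \<open>T\<close> in decreasing order, repeated according to
  multiplicity and extended by zeros: a decreasing sequence of nonnegative reals, numbered from 0,
  in which every positive \<open>r\<close> occurs as often as the complex dimension of its eigenspace (so not
  at all if \<open>r\<close> is not an eigenvalue). This is meaningful for compact \<open>T\<close>, where these eigenspaces
  are finite-dimensional. If there are infinitely many positive eigenvalues, counted with
  multiplicity, then 0 is not listed, even if it is an eigenvalue as well.\<close>

definition singular_value_seq :: "('a::complex_inner \<Rightarrow> 'a) \<Rightarrow> nat \<Rightarrow> real" where
  "singular_value_seq T = (THE s. decseq s \<and> (\<forall>n. 0 \<le> s n) \<and>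
     (\<forall>r>0. finite {n. s n = r} \<and>
        card {n. s n = r} =
          complex_vector.dim (eigenspace (abs_operator T) (complex_of_real r))))"

text \<open>The \<open>j\<close>-th singular value, counted from \<open>j = 1\<close> (the value at \<open>j = 0\<close> is junk).\<close>

definition singular_value :: "nat \<Rightarrow> ('a::complex_inner \<Rightarrow> 'a) \<Rightarrow> real" where
  "singular_value j T = singular_value_seq T (j - 1)"

end

theory Submission
  imports Defs
begin

text \<open>A compact operator \<open>T\<close> has orthogonal vectors \<open>e\<^sub>0, e\<^sub>1, \<dots>\<close>, obtained by successively maximising
  \<open>\<parallel>T x\<parallel>\<close>, such that \<open>\<parallel>T x\<parallel> \<le> s\<^sub>n(T) \<parallel>x\<parallel>\<close> for all \<open>x\<close> orthogonal to the first \<open>n\<close> of them (singular values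
  are numbered from 0); conversely, any such bound by \<open>c\<close> on the complement of \<open>n\<close> vectors forces
  \<open>s\<^sub>n(T) \<le> c\<close>. Combining the orthogonality constraints for \<open>A\<close> and \<open>B\<close> gives
  \<open>s\<^sub>a\<^sub>+\<^sub>b(A X B\<^sup>*) \<le> s\<^sub>a(A) \<parallel>X\<parallel> s\<^sub>b(B)\<close>. Since the singular values of \<open>A \<oplus> B\<close> are those of \<open>A\<close> and of \<open>B\<close>
  merged, every \<open>n\<close> can be written as \<open>a + b\<close> with \<open>s\<^sub>a(A)\<close> and \<open>s\<^sub>b(B)\<close> both at most \<open>s\<^sub>n(A \<oplus> B)\<close>.\<close>

subsection \<open>Complex inner products\<close>

lemma cinner_add_right: "cinner x (y + z) = cinner x y + cinner x z"
  by (metis cinner_add_left cinner_commute complex_cnj_add)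

lemma cinner_scaleC_right: "cinner x (a *\<^sub>C y) = cnj a * cinner x y"
  by (metis cinner_commute cinner_scaleC_left complex_cnj_mult)

lemma cinner_scaleR_left: "cinner (r *\<^sub>R x) y = complex_of_real r * cinner x y"
  by (simp add: scaleR_eq_scaleC cinner_scaleC_left)

lemma cinner_scaleR_right: "cinner x (r *\<^sub>R y) = complex_of_real r * cinner x y"
  by (simp add: scaleR_eq_scaleC cinner_scaleC_right)

lemma cinner_zero_left [simp]: "cinner 0 y = 0"
  using cinner_scaleR_left[of 0 0 y] by simp

lemma cinner_zero_right [simp]: "cinner x 0 = 0"
  using cinner_scaleR_right[of x 0 0] by simp

lemma cinner_minus_left: "cinner (- x) y = - cinner x y"
  using cinner_scaleR_left[of "-1" x y] by simp

lemma cinner_minus_right: "cinner x (- y) = - cinner x y"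
  using cinner_scaleR_right[of x "-1" y] by simp

lemma cinner_diff_left: "cinner (x - y) z = cinner x z - cinner y z"
  using cinner_add_left[of x "-y" z] by (simp add: cinner_minus_left)

lemma cinner_diff_right: "cinner x (y - z) = cinner x y - cinner x z"
  using cinner_add_right[of x y "-z"] by (simp add: cinner_minus_right)

lemma cinner_sum_left: "cinner (sum f K) y = (\<Sum>k\<in>K. cinner (f k) y)"
  by (induction K rule: infinite_finite_induct) (auto simp: cinner_add_left)

lemma cinner_sum_right: "cinner y (sum f K) = (\<Sum>k\<in>K. cinner y (f k))"
  by (induction K rule: infinite_finite_induct) (auto simp: cinner_add_right)

lemma cinner_eq_zero_commute: "cinner x y = 0 \<longleftrightarrow> cinner y x = 0"
  by (metis cinner_commute complex_cnj_zero)

lemma Re_cinner_commute: "Re (cinner x y) = Re (cinner y x)"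
  by (subst cinner_commute) simp

lemma norm_sq_cinner: "(norm x)\<^sup>2 = Re (cinner x x)"
  by (simp add: cinner_self)

lemma cinner_self_eq_zero [simp]: "cinner x x = 0 \<longleftrightarrow> x = 0"
  by (simp add: cinner_self)

lemma norm_add_sq: "(norm (x + y))\<^sup>2 = (norm x)\<^sup>2 + (norm y)\<^sup>2 + 2 * Re (cinner x y)"
  for x y :: "'a::complex_inner"
  using Re_cinner_commute[of x y] by (simp add: norm_sq_cinner cinner_add_left cinner_add_right)

lemma norm_diff_sq: "(norm (x - y))\<^sup>2 = (norm x)\<^sup>2 + (norm y)\<^sup>2 - 2 * Re (cinner x y)"
  for x y :: "'a::complex_inner"
  using norm_add_sq[of x "-y"] by (simp add: cinner_minus_right)

lemma norm_scaleC: "norm (a *\<^sub>C x) = cmod a * norm x"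
proof -
  have "(norm (a *\<^sub>C x))\<^sup>2 = Re (a * cnj a * cinner x x)"
    by (simp add: norm_sq_cinner cinner_scaleC_left cinner_scaleC_right mult.assoc mult.left_commute)
  also have "\<dots> = (cmod a * norm x)\<^sup>2"
    by (simp add: cinner_self complex_norm_square[symmetric] power_mult_distrib flip: of_real_mult of_real_power)
  finally show ?thesis by (simp add: power2_eq_iff_nonneg)
qed

text \<open>Pythagoras for the component of \<open>x\<close> orthogonal to \<open>y\<close>. For
  \<open>y = 0\<close> both correction terms vanish because division by zero yields 0. The
  nonnegative left side gives Cauchy-Schwarz.\<close>

lemma norm_diff_projection_sq:
  fixes x y :: "'a::complex_inner"
  shows "(norm (x - (cinner x y / complex_of_real ((norm y)\<^sup>2)) *\<^sub>C y))\<^sup>2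
    = (norm x)\<^sup>2 - (cmod (cinner x y))\<^sup>2 / (norm y)\<^sup>2"
proof -
  define a where "a = cinner x y / complex_of_real ((norm y)\<^sup>2)"
  have "cinner x (a *\<^sub>C y) = cinner x y * cnj (cinner x y) / complex_of_real ((norm y)\<^sup>2)"
    by (simp add: a_def cinner_scaleC_right)
  also have "\<dots> = complex_of_real ((cmod (cinner x y))\<^sup>2 / (norm y)\<^sup>2)"
    by (simp add: complex_norm_square[symmetric])
  finally have "Re (cinner x (a *\<^sub>C y)) = (cmod (cinner x y))\<^sup>2 / (norm y)\<^sup>2" by simp
  moreover have "(norm (a *\<^sub>C y))\<^sup>2 = (cmod (cinner x y))\<^sup>2 / (norm y)\<^sup>2"
  proof -
    have "cmod a = cmod (cinner x y) / (norm y)\<^sup>2"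
      by (simp add: a_def norm_divide norm_power)
    then show ?thesis by (simp add: norm_scaleC power_mult_distrib power_divide power2_eq_square)
  qed
  ultimately show ?thesis by (simp add: norm_diff_sq a_def)
qed

lemma norm_cinner_le: "cmod (cinner x y) \<le> norm x * norm y"
proof (cases "y = 0")
  case False
  have "(cmod (cinner x y))\<^sup>2 / (norm y)\<^sup>2 \<le> (norm x)\<^sup>2"
    using norm_diff_projection_sq[of x y] zero_le_power2 by (metis diff_ge_0_iff_ge)
  then have "(cmod (cinner x y))\<^sup>2 \<le> (norm x * norm y)\<^sup>2"
    using False by (simp add: divide_le_eq power_mult_distrib)
  then show ?thesis by (rule power2_le_imp_le) simp
qed simp

lemma bounded_linear_cinner_left: "bounded_linear (\<lambda>x. cinner x y)"
  by (rule bounded_linear_intro[where K = "norm y"])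
     (auto simp: cinner_add_left cinner_scaleR_left norm_cinner_le scaleR_conv_of_real)

lemma bounded_linear_scaleC_right: "bounded_linear (\<lambda>y. a *\<^sub>C y)"
  by (rule bounded_linear_intro[where K = "cmod a"])
     (auto simp: scaleC_add_right scaleR_eq_scaleC scaleC_scaleC norm_scaleC mult.commute)

lemmas tendsto_cinner_left = bounded_linear.tendsto[OF bounded_linear_cinner_left]
lemmas tendsto_scaleC_right = bounded_linear.tendsto[OF bounded_linear_scaleC_right]

lemma cinner_eqI:
  assumes "\<And>x. cinner x y = cinner x z"
  shows "y = z"
proof -
  have "cinner (y - z) (y - z) = 0" using assms by (simp add: cinner_diff_right)
  then show ?thesis by simp
qed

lemma norm_sum_orthogonal_sq:
  fixes g :: "'i \<Rightarrow> 'a::complex_inner"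
  assumes "finite K" and "\<And>i j. i \<in> K \<Longrightarrow> j \<in> K \<Longrightarrow> i \<noteq> j \<Longrightarrow> cinner (g i) (g j) = 0"
  shows "(norm (\<Sum>k\<in>K. c k *\<^sub>C g k))\<^sup>2 = (\<Sum>k\<in>K. (cmod (c k))\<^sup>2 * (norm (g k))\<^sup>2)"
  using assms
proof (induction K rule: finite_induct)
  case (insert k K)
  have "cinner (c k *\<^sub>C g k) (\<Sum>k\<in>K. c k *\<^sub>C g k) = 0"
  proof -
    have "cinner (g k) (g i) = 0" if "i \<in> K" for i
      using that insert.hyps by (intro insert.prems) auto
    then show ?thesis by (simp add: cinner_sum_right cinner_scaleC_left cinner_scaleC_right)
  qed
  then show ?case using insert by (simp add: norm_add_sq norm_scaleC power_mult_distrib)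
qed simp

subsection \<open>Bounded operators and adjoints\<close>

lemma bounded_clinearI:
  assumes "\<And>x y. T (x + y) = T x + T y" and "\<And>c x. T (c *\<^sub>C x) = c *\<^sub>C T x"
    and "\<And>x. norm (T x) \<le> norm x * K"
  shows "bounded_clinear T"
  unfolding bounded_clinear_def
  by (intro conjI bounded_linear_intro[where K = K]) (simp_all add: assms scaleR_eq_scaleC)

lemma bounded_clinear_comp:
  assumes "bounded_clinear S" "bounded_clinear T"
  shows "bounded_clinear (S \<circ> T)"
  using assms bounded_linear_compose[of S T] by (auto simp: bounded_clinear_def comp_def)

context
  fixes T :: "'a::complex_inner \<Rightarrow> 'b::complex_inner"
  assumes T: "bounded_clinear T"
begin

lemma bounded_clinear_imp_bounded_linear: "bounded_linear T"
  using T by (simp add: bounded_clinear_def)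

lemma bounded_clinear_scaleC: "T (c *\<^sub>C x) = c *\<^sub>C T x"
  using T by (simp add: bounded_clinear_def)

lemma bounded_clinear_add: "T (x + y) = T x + T y"
  using bounded_clinear_imp_bounded_linear by (simp add: linear_simps)

lemma bounded_clinear_diff: "T (x - y) = T x - T y"
  using bounded_clinear_imp_bounded_linear by (simp add: linear_simps)

lemma bounded_clinear_zero: "T 0 = 0"
  using bounded_clinear_imp_bounded_linear by (simp add: linear_simps)

lemma bounded_clinear_sum: "T (\<Sum>k\<in>K. c k *\<^sub>C g k) = (\<Sum>k\<in>K. c k *\<^sub>C T (g k))"
  by (induction K rule: infinite_finite_induct)
     (simp_all add: bounded_clinear_zero bounded_clinear_add bounded_clinear_scaleC)

lemma bounded_clinear_tendsto: "(f \<longlongrightarrow> x) F \<Longrightarrow> ((\<lambda>n. T (f n)) \<longlongrightarrow> T x) F"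
  by (rule bounded_linear.tendsto[OF bounded_clinear_imp_bounded_linear])

end

text \<open>A minimising sequence is Cauchy by the parallelogram law, because midpoints stay in
  \<open>C\<close> and so have norm at least the infimum \<open>d\<close>.\<close>

lemma minimal_norm_exists:
  fixes C :: "'a::complex_hilbert set"
  assumes "closed C" "convex C" "C \<noteq> {}"
  obtains z where "z \<in> C" "\<And>x. x \<in> C \<Longrightarrow> norm z \<le> norm x"
proof -
  define d where "d = Inf (norm ` C)"
  have bdd: "bdd_below (norm ` C)" by (rule bdd_belowI[of _ 0]) auto
  have d_le: "d \<le> norm x" if "x \<in> C" for x
    unfolding d_def using bdd that by (simp add: cInf_lower)
  have d0: "0 \<le> d" unfolding d_def using assms(3) by (intro cInf_greatest) auto
  have "\<exists>x\<in>C. norm x < d + inverse (real (Suc n))" for n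
  proof -
    have "Inf (norm ` C) < d + inverse (real (Suc n))" by (simp add: d_def)
    then show ?thesis using assms(3) by (subst (asm) cInf_less_iff[OF _ bdd]) auto
  qed
  then obtain x where x: "\<And>n. x n \<in> C" "\<And>n. norm (x n) < d + inverse (real (Suc n))"
    by metis
  have lim: "(\<lambda>n. norm (x n)) \<longlonglongrightarrow> d"
  proof (rule tendsto_sandwich[OF _ _ tendsto_const])
    show "\<forall>\<^sub>F n in sequentially. d \<le> norm (x n)" using d_le x by auto
    show "\<forall>\<^sub>F n in sequentially. norm (x n) \<le> d + inverse (real (Suc n))"
      using x(2) by (intro always_eventually allI less_imp_le)
    show "(\<lambda>n. d + inverse (real (Suc n))) \<longlonglongrightarrow> d"
      using tendsto_add[OF tendsto_const LIMSEQ_inverse_real_of_nat, of d] by simp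
  qed
  \<comment> \<open>Parallelogram law, with the norm of \<open>x m + x n\<close> bounded below by
    \<open>2 * d\<close> through the midpoint.\<close>
  have par: "(norm (x m - x n))\<^sup>2 \<le> 2 * ((norm (x m))\<^sup>2 - d\<^sup>2) + 2 * ((norm (x n))\<^sup>2 - d\<^sup>2)" for m n
  proof -
    have "(1/2) *\<^sub>R x m + (1/2) *\<^sub>R x n \<in> C"
      by (rule convexD[OF assms(2)]) (use x in auto)
    then have "d \<le> norm ((1/2) *\<^sub>R (x m + x n))" using d_le by (simp add: scaleR_add_right)
    then have "(2 * d)\<^sup>2 \<le> (norm (x m + x n))\<^sup>2" using d0 by (intro power_mono) auto
    then show ?thesis by (simp add: norm_add_sq norm_diff_sq power_mult_distrib)
  qed
  have "Cauchy x"
  proof (rule metric_CauchyI)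
    fix \<epsilon> :: real assume e: "\<epsilon> > 0"
    have "(\<lambda>n. (norm (x n))\<^sup>2) \<longlonglongrightarrow> d\<^sup>2" by (intro tendsto_intros lim)
    then have "\<forall>\<^sub>F n in sequentially. (norm (x n))\<^sup>2 < d\<^sup>2 + \<epsilon>\<^sup>2 / 4"
      by (rule order_tendstoD) (use e in simp)
    then obtain N where N: "\<And>n. n \<ge> N \<Longrightarrow> (norm (x n))\<^sup>2 < d\<^sup>2 + \<epsilon>\<^sup>2 / 4"
      by (auto simp: eventually_sequentially)
    have "dist (x m) (x n) < \<epsilon>" if "m \<ge> N" "n \<ge> N" for m n
    proof -
      have "(norm (x m - x n))\<^sup>2 < \<epsilon>\<^sup>2" using par[of m n] N[OF that(1)] N[OF that(2)] by (simp add: field_simps)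
      then show ?thesis unfolding dist_norm by (rule power2_less_imp_less) (use e in simp)
    qed
    then show "\<exists>M. \<forall>m\<ge>M. \<forall>n\<ge>M. dist (x m) (x n) < \<epsilon>" by blast
  qed
  then obtain z where z: "x \<longlonglongrightarrow> z" by (auto simp: Cauchy_convergent_iff convergent_def)
  have "z \<in> C" using closed_sequentially[OF assms(1)] x z by blast
  moreover have "norm z = d" using LIMSEQ_unique[OF tendsto_norm[OF z] lim] .
  ultimately show thesis using that d_le by blast
qed

text \<open>The shortest vector \<open>z\<close> of the affine hyperplane \<open>f x = 1\<close> is
  orthogonal to the kernel of \<open>f\<close>. As \<open>x - f x *\<^sub>C z\<close> lies in that
  kernel, pairing it with \<open>z\<close> expresses \<open>f x\<close> through
  \<open>cinner x z\<close>.\<close>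

lemma riesz_representation:
  fixes f :: "'a::complex_hilbert \<Rightarrow> complex"
  assumes f: "bounded_linear f" and fC: "\<And>c x. f (c *\<^sub>C x) = c * f x"
  obtains y where "\<And>x. f x = cinner x y"
proof (cases "\<forall>x. f x = 0")
  case True
  then show thesis using that[of 0] by simp
next
  case False
  then obtain w where w: "f w \<noteq> 0" by auto
  note lin = linear_simps[OF f]
  define C where "C = {x. f x = 1}"
  have "closed C"
    unfolding C_def by (intro closed_Collect_eq continuous_intros linear_continuous_on f)
  moreover have "convex C"
    unfolding convex_def C_def
    by (auto simp: lin scaleR_conv_of_real simp flip: of_real_add)
  moreover have "inverse (f w) *\<^sub>C w \<in> C" using w by (simp add: C_def fC)
  ultimately obtain z where z: "z \<in> C" "\<And>x. x \<in> C \<Longrightarrow> norm z \<le> norm x"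
    using minimal_norm_exists[of C] by blast
  have fz: "f z = 1" using z by (simp add: C_def)
  then have nz: "z \<noteq> 0" using lin(3) by auto
  \<comment> \<open>Moving \<open>z\<close> along a kernel vector \<open>x\<close> stays in
    \<open>C\<close>. Removing the projection of \<open>z\<close> onto \<open>x\<close> would
    shorten \<open>z\<close>, unless that projection is zero.\<close>
  have orth: "cinner x z = 0" if "f x = 0" for x
  proof (cases "x = 0")
    case False
    define a where "a = cinner z x / complex_of_real ((norm x)\<^sup>2)"
    have "z - a *\<^sub>C x \<in> C" by (simp add: C_def lin fC fz that)
    then have "(norm z)\<^sup>2 \<le> (norm (z - a *\<^sub>C x))\<^sup>2" using z(2) by (intro power_mono) auto
    also have "\<dots> = (norm z)\<^sup>2 - (cmod (cinner z x))\<^sup>2 / (norm x)\<^sup>2"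
      unfolding a_def by (rule norm_diff_projection_sq)
    finally have "(cmod (cinner z x))\<^sup>2 / (norm x)\<^sup>2 \<le> 0" by simp
    then have "cinner z x = 0" using False by (simp add: divide_le_0_iff)
    then show ?thesis by (simp add: cinner_eq_zero_commute)
  qed simp
  have "f x = cinner x ((1 / (norm z)\<^sup>2) *\<^sub>R z)" for x
  proof -
    have "cinner (x - f x *\<^sub>C z) z = 0" by (rule orth) (simp add: lin fC fz)
    then have "cinner x z = f x * complex_of_real ((norm z)\<^sup>2)"
      by (simp add: cinner_diff_left cinner_scaleC_left cinner_self)
    then show ?thesis using nz by (simp add: cinner_scaleR_right)
  qed
  then show thesis using that by blast
qed

text \<open>The definite description in \<open>cadjoint\<close> needs both parts: Riesz
  representation for each \<open>y\<close> gives existence, and \<open>cinner_eqI\<close> gives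
  uniqueness.\<close>

lemma cinner_cadjoint:
  fixes T :: "'a::complex_hilbert \<Rightarrow> 'b::complex_inner"
  assumes T: "bounded_clinear T"
  shows "cinner (T x) y = cinner x (cadjoint T y)"
proof -
  have "\<exists>z. \<forall>x. cinner (T x) y = cinner x z" for y
  proof -
    have "bounded_linear (\<lambda>x. cinner (T x) y)"
      by (rule bounded_linear_compose[OF bounded_linear_cinner_left bounded_clinear_imp_bounded_linear[OF T]])
    from riesz_representation[OF this] show ?thesis
      by (metis bounded_clinear_scaleC[OF T] cinner_scaleC_left)
  qed
  then obtain S where S: "\<forall>x y. cinner (T x) y = cinner x (S y)" by metis
  have "S' = S" if "\<forall>x y. cinner (T x) y = cinner x (S' y)" for S'
    by (rule ext, rule cinner_eqI) (use S that in metis)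
  then have "\<forall>x y. cinner (T x) y = cinner x (cadjoint T y)"
    unfolding cadjoint_def by (rule theI[where P = "\<lambda>S. \<forall>x y. cinner (T x) y = cinner x (S y)", OF S])
  then show ?thesis by blast
qed

lemma cinner_cadjoint_left:
  fixes T :: "'a::complex_hilbert \<Rightarrow> 'b::complex_inner"
  assumes T: "bounded_clinear T"
  shows "cinner (cadjoint T x) y = cinner x (T y)"
  by (metis cinner_cadjoint[OF T] cinner_commute)

lemma bounded_clinear_cadjoint:
  fixes T :: "'a::complex_hilbert \<Rightarrow> 'b::complex_inner"
  assumes T: "bounded_clinear T"
  shows "bounded_clinear (cadjoint T)"
proof -
  note adj = cinner_cadjoint[OF T, symmetric]
  obtain K where K: "\<And>x. norm (T x) \<le> norm x * K" and K0: "0 < K"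
    using bounded_linear.pos_bounded[OF bounded_clinear_imp_bounded_linear[OF T]] by blast
  show ?thesis
  proof (rule bounded_clinearI)
    show "cadjoint T (x + y) = cadjoint T x + cadjoint T y" for x y
      by (rule cinner_eqI) (simp add: adj cinner_add_right)
    show "cadjoint T (c *\<^sub>C x) = c *\<^sub>C cadjoint T x" for c x
      by (rule cinner_eqI) (simp add: adj cinner_scaleC_right)
    show "norm (cadjoint T y) \<le> norm y * K" for y
    proof (cases "cadjoint T y = 0")
      case True
      then show ?thesis using K0 by simp
    next
      case False
      let ?x = "cadjoint T y"
      \<comment> \<open>Bounding \<open>(norm ?x)\<^sup>2\<close> by a multiple of
        \<open>norm ?x\<close> and cancelling one factor transfers the bound of \<open>T\<close> to
        its adjoint.\<close>
      have "(norm ?x)\<^sup>2 = cmod (cinner (T ?x) y)" by (simp add: cinner_cadjoint[OF T] cinner_self norm_power)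
      also have "\<dots> \<le> norm (T ?x) * norm y" by (rule norm_cinner_le)
      also have "\<dots> \<le> norm ?x * K * norm y" by (intro mult_right_mono K) auto
      finally show ?thesis using False by (simp add: power2_eq_square mult.assoc mult.commute)
    qed
  qed
qed

subsection \<open>Singular systems of compact operators\<close>

lemma compact_operator_imp_bounded_clinear: "compact_operator T \<Longrightarrow> bounded_clinear T"
  by (simp add: compact_operator_def)

lemma cinner_cadjoint_self:
  fixes T :: "'a::complex_hilbert \<Rightarrow> 'b::complex_inner"
  assumes "bounded_clinear T"
  shows "cinner (cadjoint T (T x)) x = complex_of_real ((norm (T x))\<^sup>2)"
  by (simp add: cinner_cadjoint_left[OF assms] cinner_self)

text \<open>Let \<open>V\<close> be the orthogonal complement of \<open>F\<close> and
  \<open>m\<close> the norm of \<open>T\<close> on \<open>V\<close>. Since \<open>F\<close> consists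
  of eigenvectors of \<open>cadjoint T \<circ> T\<close> (or zero), \<open>V\<close> is invariant
  under that operator. Along a maximising sequence the eigenvector defect tends to 0; compactness
  makes the images converge along a subsequence, and the small defect then makes the vectors
  themselves converge. If \<open>m = 0\<close>, the zero vector is returned.\<close>

lemma extremal_vector:
  fixes T :: "'a::complex_hilbert \<Rightarrow> 'b::complex_inner"
  assumes T: "compact_operator T"
    and F: "\<And>f. f \<in> F \<Longrightarrow> \<exists>c. cadjoint T (T f) = c *\<^sub>C f"
  obtains v m where "0 \<le> m" "norm v = (if m = 0 then 0 else 1)" "\<forall>f\<in>F. cinner v f = 0"
    "cadjoint T (T v) = m\<^sup>2 *\<^sub>R v"
    "\<forall>x. (\<forall>f\<in>F. cinner x f = 0) \<longrightarrow> norm (T x) \<le> m * norm x"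
proof -
  note bT = compact_operator_imp_bounded_clinear[OF T]
  note bT' = bounded_clinear_cadjoint[OF bT]
  define V where "V = {x. \<forall>f\<in>F. cinner x f = 0}"
  define m where "m = Sup ((\<lambda>x. norm (T x)) ` (V \<inter> cball 0 1))"
  obtain K where K: "\<And>x. norm (T x) \<le> norm x * K" and K0: "0 < K"
    using bounded_linear.pos_bounded[OF bounded_clinear_imp_bounded_linear[OF bT]] by blast
  have bdd: "bdd_above ((\<lambda>x. norm (T x)) ` (V \<inter> cball 0 1))"
  proof (rule bdd_aboveI2)
    fix x assume "x \<in> V \<inter> cball 0 1"
    then have "norm x * K \<le> 1 * K" using K0 by (intro mult_right_mono) auto
    then show "norm (T x) \<le> K" using K[of x] by simp
  qed
  have V0: "0 \<in> V" by (simp add: V_def)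
  have le_m: "norm (T x) \<le> m" if "x \<in> V" "norm x \<le> 1" for x
    unfolding m_def by (rule cSup_upper[OF _ bdd]) (use that in auto)
  have m0: "0 \<le> m" using le_m[OF V0] by (simp add: bounded_clinear_zero[OF bT])
  have bound: "norm (T x) \<le> m * norm x" if x: "x \<in> V" for x
  proof (cases "x = 0")
    case False
    have "complex_of_real (1 / norm x) *\<^sub>C x \<in> V" using x by (simp add: V_def cinner_scaleC_left)
    then have "norm (T (complex_of_real (1 / norm x) *\<^sub>C x)) \<le> m"
      using False by (intro le_m) (simp_all add: norm_scaleC norm_divide)
    then show ?thesis
      using False by (simp add: bounded_clinear_scaleC[OF bT] norm_scaleC norm_divide divide_le_eq)
  qed (simp add: bounded_clinear_zero[OF bT])
  show thesis
  proof (cases "m = 0")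
    case True
    have "\<forall>x. (\<forall>f\<in>F. cinner x f = 0) \<longrightarrow> norm (T x) \<le> m * norm x"
      using bound by (simp add: V_def)
    then show thesis
      by (intro that[of m 0]) (simp_all add: True bounded_clinear_zero[OF bT] bounded_clinear_zero[OF bT'])
  next
    case False
    with m0 have mpos: "m > 0" by simp
    have "\<exists>x\<in>V \<inter> cball 0 1. m - inverse (real (Suc n)) < norm (T x)" for n
    proof -
      have "m - inverse (real (Suc n)) < Sup ((\<lambda>x. norm (T x)) ` (V \<inter> cball 0 1))"
        by (simp add: m_def)
      then show ?thesis using V0 by (subst (asm) less_cSup_iff[OF _ bdd]) auto
    qed
    then obtain x where x: "\<And>n. x n \<in> V" "\<And>n. norm (x n) \<le> 1"
      "\<And>n. m - inverse (real (Suc n)) < norm (T (x n))"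
      unfolding Bex_def Int_iff mem_cball_0 by metis
    have lim: "(\<lambda>n. norm (T (x n))) \<longlonglongrightarrow> m"
    proof (rule tendsto_sandwich[OF _ _ _ tendsto_const])
      show "\<forall>\<^sub>F n in sequentially. m - inverse (real (Suc n)) \<le> norm (T (x n))"
        using x(3) by (intro always_eventually allI less_imp_le)
      show "\<forall>\<^sub>F n in sequentially. norm (T (x n)) \<le> m"
        using x by (intro always_eventually allI le_m)
      show "(\<lambda>n. m - inverse (real (Suc n))) \<longlonglongrightarrow> m"
        using tendsto_diff[OF tendsto_const LIMSEQ_inverse_real_of_nat, of m] by simp
    qed
    \<comment> \<open>Expand the square: the first term is at most
      \<open>m\<^sup>2 * (norm (T y))\<^sup>2\<close>, the cross term is exactly minus twice this,
      and the last term is at most \<open>m\<^sup>2 * m\<^sup>2\<close>. The right side vanishes as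
      \<open>norm (T y)\<close> approaches \<open>m\<close>.\<close>
    have defect: "(norm (cadjoint T (T y) - m\<^sup>2 *\<^sub>R y))\<^sup>2 \<le> m\<^sup>2 * m\<^sup>2 - m\<^sup>2 * (norm (T y))\<^sup>2"
      if y: "y \<in> V" "norm y \<le> 1" for y
    proof -
      let ?z = "cadjoint T (T y)"
      have zV: "?z \<in> V"
      proof -
        have "cinner ?z f = 0" if f: "f \<in> F" for f
        proof -
          obtain c where c: "cadjoint T (T f) = c *\<^sub>C f" using F[OF f] by blast
          have "cinner ?z f = cinner y (cadjoint T (T f))"
            by (simp add: cinner_cadjoint_left[OF bT] cinner_cadjoint[OF bT])
          then show ?thesis using y f by (simp add: c cinner_scaleC_right V_def)
        qed
        then show ?thesis by (simp add: V_def)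
      qed
      have "norm ?z \<le> m * norm (T y)"
      proof (cases "norm ?z = 0")
        case False
        have "norm ?z * norm ?z = cmod (cinner (T ?z) (T y))"
          by (simp add: cinner_cadjoint[OF bT] cinner_self norm_power power2_eq_square norm_mult)
        also have "\<dots> \<le> norm (T ?z) * norm (T y)" by (rule norm_cinner_le)
        also have "\<dots> \<le> m * norm ?z * norm (T y)" by (intro mult_right_mono bound zV) auto
        finally have "norm ?z * norm ?z \<le> norm ?z * (m * norm (T y))" by (simp add: mult_ac)
        then show ?thesis using False by (subst (asm) mult_le_cancel_left_pos) auto
      qed (use m0 in auto)
      then have "(norm ?z)\<^sup>2 \<le> m\<^sup>2 * (norm (T y))\<^sup>2"
        using power_mono[of "norm ?z" "m * norm (T y)" 2] by (simp add: power_mult_distrib)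
      moreover have "Re (cinner ?z (m\<^sup>2 *\<^sub>R y)) = m\<^sup>2 * (norm (T y))\<^sup>2"
        by (simp add: cinner_scaleR_right cinner_cadjoint_self[OF bT] flip: of_real_power of_real_mult)
      moreover have "(norm (m\<^sup>2 *\<^sub>R y))\<^sup>2 \<le> m\<^sup>2 * m\<^sup>2"
      proof -
        have "(norm (m\<^sup>2 *\<^sub>R y))\<^sup>2 = m\<^sup>2 * m\<^sup>2 * (norm y)\<^sup>2"
          by (simp add: power2_eq_square)
        also have "\<dots> \<le> m\<^sup>2 * m\<^sup>2 * 1"
          using y(2) by (intro mult_left_mono) (simp_all add: power_le_one)
        finally show ?thesis by simp
      qed
      ultimately show ?thesis by (simp add: norm_diff_sq)
    qed
    have defect_lim: "(\<lambda>n. cadjoint T (T (x n)) - m\<^sup>2 *\<^sub>R x n) \<longlonglongrightarrow> 0"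
    proof -
      have "(\<lambda>n. m\<^sup>2 * m\<^sup>2 - m\<^sup>2 * (norm (T (x n)))\<^sup>2) \<longlonglongrightarrow> m\<^sup>2 * m\<^sup>2 - m\<^sup>2 * m\<^sup>2"
        by (intro tendsto_intros lim)
      then have *: "(\<lambda>n. m\<^sup>2 * m\<^sup>2 - m\<^sup>2 * (norm (T (x n)))\<^sup>2) \<longlonglongrightarrow> 0" by simp
      have "(\<lambda>n. (norm (cadjoint T (T (x n)) - m\<^sup>2 *\<^sub>R x n))\<^sup>2) \<longlonglongrightarrow> 0"
        by (rule tendsto_sandwich[OF _ _ tendsto_const *]) (use defect x in auto)
      from tendsto_real_sqrt[OF this] show ?thesis by (simp add: tendsto_norm_zero_iff)
    qed
    have "seq_compact (closure (T ` cball 0 1))"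
      using T by (simp add: compact_operator_def compact_imp_seq_compact)
    moreover have "\<forall>n. T (x n) \<in> closure (T ` cball 0 1)"
      using x by (intro allI subsetD[OF closure_subset]) auto
    ultimately obtain l r where r: "strict_mono r" "(\<lambda>n. T (x (r n))) \<longlonglongrightarrow> l"
      by (rule seq_compactE) (simp add: comp_def)
    \<comment> \<open>Solving the defect for \<open>x (r n)\<close> and passing to the limit forces
      this value.\<close>
    define z where "z = (1 / m\<^sup>2) *\<^sub>R cadjoint T l"
    have "(\<lambda>n. (1 / m\<^sup>2) *\<^sub>R (cadjoint T (T (x (r n))) - (cadjoint T (T (x (r n))) - m\<^sup>2 *\<^sub>R x (r n))))
        \<longlonglongrightarrow> (1 / m\<^sup>2) *\<^sub>R (cadjoint T l - 0)"
      using LIMSEQ_subseq_LIMSEQ[OF defect_lim r(1)]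
      by (intro tendsto_intros bounded_clinear_tendsto[OF bT'] r) (simp add: comp_def)
    then have xz: "(\<lambda>n. x (r n)) \<longlonglongrightarrow> z" using mpos by (simp add: z_def)
    have "l = T z" by (rule LIMSEQ_unique[OF r(2) bounded_clinear_tendsto[OF bT xz]])
    moreover have "norm l = m"
      by (rule LIMSEQ_unique[OF tendsto_norm[OF r(2)]])
        (use LIMSEQ_subseq_LIMSEQ[OF lim r(1)] in \<open>simp add: comp_def\<close>)
    ultimately have Tz: "norm (T z) = m" "cadjoint T (T z) = m\<^sup>2 *\<^sub>R z"
      using mpos by (simp_all add: z_def)
    have zF: "cinner z f = 0" if "f \<in> F" for f
    proof -
      have "(\<lambda>n. cinner (x (r n)) f) \<longlonglongrightarrow> cinner z f" by (rule tendsto_cinner_left[OF xz])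
      moreover have "cinner (x n) f = 0" for n using x(1) that by (auto simp: V_def)
      ultimately show ?thesis by (simp add: LIMSEQ_const_iff)
    qed
    have "norm z \<le> 1"
      by (rule LIMSEQ_le_const2[OF tendsto_norm[OF xz]]) (use x in auto)
    \<comment> \<open>The maximum is attained at \<open>z\<close>, so the bound on \<open>V\<close>
      applied to \<open>z\<close> itself rules out a norm below 1.\<close>
    moreover have "m * 1 \<le> m * norm z" using bound[of z] zF Tz(1) by (simp add: V_def)
    then have "1 \<le> norm z" using mpos by (subst (asm) mult_le_cancel_left_pos) auto
    ultimately have "norm z = 1" by simp
    moreover have "\<forall>x. (\<forall>f\<in>F. cinner x f = 0) \<longrightarrow> norm (T x) \<le> m * norm x"
      using bound by (simp add: V_def)
    ultimately show thesis
      using mpos zF Tz by (intro that[of m z]) simp_all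
  qed
qed

text \<open>Once \<open>s\<close> reaches 0, the sequence \<open>e\<close> is padded with zero vectors, so that finite rank and finite
  dimension need no separate treatment.\<close>

locale singular_system =
  fixes T :: "'a::complex_hilbert \<Rightarrow> 'a" and e :: "nat \<Rightarrow> 'a" and s :: "nat \<Rightarrow> real"
  assumes compact: "compact_operator T"
    and nonneg: "0 \<le> s n"
    and norm_e: "norm (e n) = (if s n = 0 then 0 else 1)"
    and orth: "i \<noteq> j \<Longrightarrow> cinner (e i) (e j) = 0"
    and eig: "cadjoint T (T (e n)) = (s n)\<^sup>2 *\<^sub>R e n"
    and bound: "(\<And>k. k < n \<Longrightarrow> cinner x (e k) = 0) \<Longrightarrow> norm (T x) \<le> s n * norm x"

text \<open>Dependent choice over the natural numbers: stage \<open>n\<close> applies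
  \<open>extremal_vector\<close> to the vectors chosen earlier, whose eigenvector equations are part
  of \<open>P\<close> and supply its hypothesis.\<close>

lemma singular_system_exists:
  fixes T :: "'a::complex_hilbert \<Rightarrow> 'a"
  assumes T: "compact_operator T"
  obtains e s where "singular_system T e s"
proof -
  define P :: "(nat \<Rightarrow> 'a \<times> real) \<Rightarrow> nat \<Rightarrow> 'a \<times> real \<Rightarrow> bool" where
    "P f n r \<longleftrightarrow> 0 \<le> snd r \<and> norm (fst r) = (if snd r = 0 then 0 else 1)
      \<and> (\<forall>k<n. cinner (fst r) (fst (f k)) = 0)
      \<and> cadjoint T (T (fst r)) = (snd r)\<^sup>2 *\<^sub>R fst r
      \<and> (\<forall>x. (\<forall>k<n. cinner x (fst (f k)) = 0) \<longrightarrow> norm (T x) \<le> snd r * norm x)" for f n r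
  have "\<exists>f. \<forall>n. P f n (f n)"
  proof (rule dependent_wf_choice[OF wf_less])
    \<comment> \<open>The choice principle requires that \<open>P f n\<close> consult
      \<open>f\<close> only below \<open>n\<close>.\<close>
    show "P f n r = P g n r" if "\<And>k. (k, n) \<in> {(x, y). x < y} \<Longrightarrow> f k = g k" for f g n r
      using that by (auto simp: P_def)
  next
    fix n f assume *: "\<And>k. (k, n) \<in> {(x, y). x < y} \<Longrightarrow> P f k (f k)"
    have "\<exists>c. cadjoint T (T y) = c *\<^sub>C y" if "y \<in> (\<lambda>k. fst (f k)) ` {..<n}" for y
      using that * by (auto simp: P_def scaleR_eq_scaleC)
    then obtain v m where "0 \<le> m" "norm v = (if m = 0 then 0 else 1)"
      "\<forall>y\<in>(\<lambda>k. fst (f k)) ` {..<n}. cinner v y = 0" "cadjoint T (T v) = m\<^sup>2 *\<^sub>R v"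
      "\<forall>x. (\<forall>y\<in>(\<lambda>k. fst (f k)) ` {..<n}. cinner x y = 0) \<longrightarrow> norm (T x) \<le> m * norm x"
      by (rule extremal_vector[OF T])
    then have "P f n (v, m)" by (auto simp: P_def)
    then show "\<exists>r. P f n r" by blast
  qed
  then obtain f where f: "\<And>n. P f n (f n)" by blast
  have "singular_system T (\<lambda>n. fst (f n)) (\<lambda>n. snd (f n))"
  proof
    show "cinner (fst (f i)) (fst (f j)) = 0" if "i \<noteq> j" for i j
      using f[of i] f[of j] that by (cases i j rule: linorder_cases) (auto simp: P_def cinner_eq_zero_commute)
  qed (use f T in \<open>auto simp: P_def\<close>)
  then show thesis by (rule that)
qed

text \<open>Polarisation: the quadratic form of \<open>Q\<close> is real, and evaluating it at
  \<open>x + y\<close> and at \<open>x + \<i> *\<^sub>C y\<close> compares the imaginary and the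
  real parts of the two mixed terms.\<close>

lemma positive_operator_cinner:
  assumes Q: "positive_operator Q"
  shows "cinner (Q x) y = cinner x (Q y)"
proof -
  have bQ: "bounded_clinear Q" using Q by (simp add: positive_operator_def)
  have re: "Im (cinner (Q x) x) = 0" for x
    using Q by (auto simp: positive_operator_def complex_nonneg_Reals_iff)
  have 1: "Im (cinner (Q x) y) + Im (cinner (Q y) x) = 0"
    using re[of "x + y"] re[of x] re[of y]
    by (simp add: bounded_clinear_add[OF bQ] cinner_add_left cinner_add_right)
  have 2: "Re (cinner (Q y) x) - Re (cinner (Q x) y) = 0"
    using re[of "x + \<i> *\<^sub>C y"] re[of x] re[of y]
    by (simp add: bounded_clinear_add[OF bQ] bounded_clinear_scaleC[OF bQ] cinner_add_left cinner_add_right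
        cinner_scaleC_left cinner_scaleC_right algebra_simps)
  have "cinner (Q x) y = cnj (cinner (Q y) x)" using 1 2 by (simp add: complex_eq_iff)
  then show ?thesis by (metis cinner_commute)
qed

text \<open>Counting argument for the uniqueness of the sequence in
  \<open>singular_value_seq\<close>. If \<open>t n < s n\<close>, the indices \<open>0\<close> to
  \<open>n\<close> of \<open>s\<close> occupy levels at least \<open>s n\<close>. Equally many
  indices of \<open>t\<close> occupy these levels, but they all lie below \<open>n\<close>, so
  \<open>n + 1 \<le> n\<close>.\<close>

lemma level_card_imp_le:
  fixes s t :: "nat \<Rightarrow> real"
  assumes s: "decseq s" and t: "decseq t" "\<And>n. 0 \<le> t n"
    and card: "\<And>r. r > 0 \<Longrightarrow> finite {n. s n = r} \<and> finite {n. t n = r} \<and> card {n. s n = r} = card {n. t n = r}"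
  shows "s n \<le> t n"
proof (rule ccontr)
  assume "\<not> s n \<le> t n"
  then have lt: "t n < s n" by simp
  have pos: "0 < s k" if "k \<le> n" for k
    using lt t(2)[of n] decseqD[OF s that] by linarith
  define R where "R = s ` {..n}"
  have R: "\<And>r. r \<in> R \<Longrightarrow> r > 0" "\<And>r. r \<in> R \<Longrightarrow> s n \<le> r"
    using pos decseqD[OF s] by (auto simp: R_def)
  have "Suc n = card {..n}" by simp
  also have "\<dots> \<le> card (\<Union>r\<in>R. {k. s k = r})"
    by (intro card_mono finite_UN_I) (use R card in \<open>auto simp: R_def\<close>)
  also have "\<dots> = (\<Sum>r\<in>R. card {k. s k = r})"
    by (rule card_UN_disjoint) (use R card in \<open>auto simp: R_def\<close>)
  also have "\<dots> = (\<Sum>r\<in>R. card {k. t k = r})" using R card by (intro sum.cong) auto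
  also have "\<dots> = card (\<Union>r\<in>R. {k. t k = r})"
    by (rule card_UN_disjoint[symmetric]) (use R card in \<open>auto simp: R_def\<close>)
  also have "\<dots> \<le> card {..<n}"
  proof (intro card_mono)
    show "(\<Union>r\<in>R. {k. t k = r}) \<subseteq> {..<n}"
    proof safe
      fix k assume "t k \<in> R"
      then have "s n \<le> t k" using R by blast
      then show "k < n" using lt decseqD[OF t(1), of n k] by (cases "n \<le> k") auto
    qed
  qed simp
  finally show False by simp
qed

context singular_system
begin

lemma bounded: "bounded_clinear T"
  using compact by (rule compact_operator_imp_bounded_clinear)

lemma cinner_e: "cinner (e i) (e j) = (if i = j \<and> s i \<noteq> 0 then 1 else 0)"
  using norm_e[of i] by (cases "i = j") (simp_all add: orth cinner_self)

lemma e_eq_0: "s n = 0 \<Longrightarrow> e n = 0"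
  using norm_e[of n] by simp

lemma cinner_T_e: "i \<noteq> j \<Longrightarrow> cinner (T (e i)) (T (e j)) = 0"
  by (simp add: cinner_cadjoint[OF bounded] eig cinner_scaleR_right orth)

lemma norm_T_e: "norm (T (e n)) = s n"
proof -
  have "cinner (cadjoint T (T (e n))) (e n) = complex_of_real ((s n)\<^sup>2)"
    by (simp add: eig cinner_scaleR_left cinner_e)
  then have "(norm (T (e n)))\<^sup>2 = (s n)\<^sup>2" unfolding cinner_cadjoint_self[OF bounded] of_real_eq_iff .
  then show ?thesis using nonneg[of n] by (simp add: power2_eq_iff_nonneg)
qed

lemma s_antimono: "m \<le> n \<Longrightarrow> s n \<le> s m"
proof -
  have "s (Suc n) \<le> s n" for n
  proof (cases "s (Suc n) = 0")
    case False
    have "norm (T (e (Suc n))) \<le> s n * norm (e (Suc n))" by (rule bound) (simp add: orth)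
    then show ?thesis using False norm_e[of "Suc n"] by (simp add: norm_T_e)
  qed (simp add: nonneg)
  then show "m \<le> n \<Longrightarrow> s n \<le> s m" by (rule lift_Suc_antimono_le)
qed

text \<open>The images \<open>T (e n)\<close> are mutually orthogonal with norms
  \<open>s n \<ge> L\<close>, so distinct ones are at least \<open>L\<close> apart. Compactness
  yields a convergent subsequence, which forces \<open>L = 0\<close>.\<close>

lemma s_tendsto_0: "s \<longlonglongrightarrow> 0"
proof -
  have "decseq s" using s_antimono by (simp add: decseq_def)
  then obtain L where L: "s \<longlonglongrightarrow> L" "\<And>n. L \<le> s n"
    using decseq_convergent[of s 0] nonneg by metis
  have L0: "0 \<le> L" using LIMSEQ_le_const[OF L(1)] nonneg by blast
  have "seq_compact (closure (T ` cball 0 1))"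
    using compact by (simp add: compact_operator_def compact_imp_seq_compact)
  moreover have "\<forall>n. T (e n) \<in> closure (T ` cball 0 1)"
    using norm_e by (intro allI subsetD[OF closure_subset]) auto
  ultimately obtain l r where r: "strict_mono r" "(\<lambda>n. T (e (r n))) \<longlonglongrightarrow> l"
    by (rule seq_compactE) (simp add: comp_def)
  have "(\<lambda>n. norm (T (e (r (Suc n))) - T (e (r n)))) \<longlonglongrightarrow> norm (l - l)"
    by (intro tendsto_intros r LIMSEQ_Suc[OF r(2)])
  then have lim: "(\<lambda>n. norm (T (e (r (Suc n))) - T (e (r n)))) \<longlonglongrightarrow> 0" by simp
  have "L \<le> norm (T (e (r (Suc n))) - T (e (r n)))" for n
  proof (rule power2_le_imp_le)
    have "r (Suc n) \<noteq> r n" using r(1) by (metis n_not_Suc_n strict_mono_eq)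
    then have "(norm (T (e (r (Suc n))) - T (e (r n))))\<^sup>2 = (s (r (Suc n)))\<^sup>2 + (s (r n))\<^sup>2"
      by (simp add: norm_diff_sq cinner_T_e norm_T_e)
    moreover have "L\<^sup>2 \<le> (s (r n))\<^sup>2" using L(2) L0 by (intro power_mono)
    ultimately show "L\<^sup>2 \<le> (norm (T (e (r (Suc n))) - T (e (r n))))\<^sup>2"
      using zero_le_power2[of "s (r (Suc n))"] by linarith
  qed simp
  then have "L \<le> 0" by (intro LIMSEQ_le_const[OF lim]) auto
  then show ?thesis using L L0 by simp
qed

section \<open>Orthogonal projection onto the first singular vectors, and its remainder\<close>

definition expansion :: "nat \<Rightarrow> 'a \<Rightarrow> 'a" where
  "expansion n x = (\<Sum>k<n. cinner x (e k) *\<^sub>C e k)"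

lemma cinner_remainder:
  assumes "k < n"
  shows "cinner (x - expansion n x) (e k) = 0"
proof -
  have "cinner (expansion n x) (e k) = (\<Sum>i<n. if i = k then cinner x (e k) else 0)"
    unfolding expansion_def cinner_sum_left
    by (rule sum.cong) (auto simp: cinner_scaleC_left cinner_e e_eq_0)
  then show ?thesis using assms by (simp add: cinner_diff_left)
qed

lemma norm_sq_expansion: "(norm (x - expansion n x))\<^sup>2 + (norm (expansion n x))\<^sup>2 = (norm x)\<^sup>2"
proof -
  have "cinner (x - expansion n x) (expansion n x) = 0"
    by (subst (2) expansion_def) (simp add: cinner_sum_right cinner_scaleC_right cinner_remainder)
  then show ?thesis using norm_add_sq[of "x - expansion n x" "expansion n x"] by simp
qed

lemma norm_expansion_le: "norm (expansion n x) \<le> norm x"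
proof (rule power2_le_imp_le)
  show "(norm (expansion n x))\<^sup>2 \<le> (norm x)\<^sup>2"
    using norm_sq_expansion[of x n] zero_le_power2[of "norm (x - expansion n x)"] by linarith
qed simp

lemma norm_remainder_le: "norm (x - expansion n x) \<le> norm x"
proof (rule power2_le_imp_le)
  show "(norm (x - expansion n x))\<^sup>2 \<le> (norm x)\<^sup>2"
    using norm_sq_expansion[of x n] zero_le_power2[of "norm (expansion n x)"] by linarith
qed simp

text \<open>The remainder is orthogonal to the first \<open>n\<close> vectors, so
  \<open>bound\<close> applies with factor \<open>s n\<close>. The remainder itself need not tend to
  0: a vector in the kernel of \<open>T\<close> has zero expansion.\<close>

lemma T_remainder_tendsto_0: "(\<lambda>n. T (x - expansion n x)) \<longlonglongrightarrow> 0"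
proof (rule tendsto_norm_zero_cancel, rule tendsto_sandwich[OF _ _ tendsto_const])
  have "norm (T (x - expansion n x)) \<le> s n * norm x" for n
    using bound[of n "x - expansion n x", OF cinner_remainder]
      mult_left_mono[OF norm_remainder_le[of x n] nonneg[of n]] by linarith
  then show "\<forall>\<^sub>F n in sequentially. norm (T (x - expansion n x)) \<le> s n * norm x" by simp
  show "(\<lambda>n. s n * norm x) \<longlonglongrightarrow> 0" by (rule tendsto_mult_left_zero[OF s_tendsto_0])
qed simp

section \<open>The absolute value of \<open>T\<close> as a diagonal series\<close>

definition root_sum :: "nat \<Rightarrow> 'a \<Rightarrow> 'a" where
  "root_sum n x = (\<Sum>k<n. (complex_of_real (s k) * cinner x (e k)) *\<^sub>C e k)"

definition root_op :: "'a \<Rightarrow> 'a" where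
  "root_op x = lim (\<lambda>n. root_sum n x)"

text \<open>By orthogonality the square of the tail is a sum of squares;
  \<open>s k \<le> s m\<close> can be pulled out, and Bessel's inequality bounds the rest. This
  gives convergence of the series and, at \<open>m = 0\<close>, boundedness of its limit.\<close>

lemma norm_root_sum_diff:
  assumes "m \<le> n"
  shows "norm (root_sum n x - root_sum m x) \<le> s m * norm x"
proof (rule power2_le_imp_le)
  have *: "root_sum n x - root_sum m x = (\<Sum>k\<in>{m..<n}. (complex_of_real (s k) * cinner x (e k)) *\<^sub>C e k)"
    using assms unfolding root_sum_def by (simp add: sum_diff_nat_ivl flip: atLeast0LessThan)
  have "(norm (root_sum n x - root_sum m x))\<^sup>2
      = (\<Sum>k\<in>{m..<n}. (cmod (complex_of_real (s k) * cinner x (e k)))\<^sup>2 * (norm (e k))\<^sup>2)"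
    unfolding * by (rule norm_sum_orthogonal_sq) (auto simp: orth)
  also have "\<dots> \<le> (\<Sum>k\<in>{m..<n}. (s m)\<^sup>2 * ((cmod (cinner x (e k)))\<^sup>2 * (norm (e k))\<^sup>2))"
  proof (rule sum_mono)
    fix k assume "k \<in> {m..<n}"
    then have "(s k)\<^sup>2 \<le> (s m)\<^sup>2" by (intro power_mono s_antimono nonneg) auto
    then have "(s k)\<^sup>2 * ((cmod (cinner x (e k)))\<^sup>2 * (norm (e k))\<^sup>2)
        \<le> (s m)\<^sup>2 * ((cmod (cinner x (e k)))\<^sup>2 * (norm (e k))\<^sup>2)"
      by (intro mult_right_mono) auto
    then show "(cmod (complex_of_real (s k) * cinner x (e k)))\<^sup>2 * (norm (e k))\<^sup>2
        \<le> (s m)\<^sup>2 * ((cmod (cinner x (e k)))\<^sup>2 * (norm (e k))\<^sup>2)"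
      by (simp add: norm_mult power_mult_distrib mult.assoc)
  qed
  also have "\<dots> \<le> (\<Sum>k<n. (s m)\<^sup>2 * ((cmod (cinner x (e k)))\<^sup>2 * (norm (e k))\<^sup>2))"
    by (rule sum_mono2) auto
  also have "\<dots> = (s m)\<^sup>2 * (norm (expansion n x))\<^sup>2"
    unfolding expansion_def by (subst norm_sum_orthogonal_sq) (auto simp: orth sum_distrib_left)
  also have "\<dots> \<le> (s m)\<^sup>2 * (norm x)\<^sup>2"
    by (intro mult_left_mono power_mono norm_expansion_le) auto
  finally show "(norm (root_sum n x - root_sum m x))\<^sup>2 \<le> (s m * norm x)\<^sup>2"
    by (simp add: power_mult_distrib)
qed (simp add: nonneg)

lemma root_sum_tendsto: "(\<lambda>n. root_sum n x) \<longlonglongrightarrow> root_op x"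
proof -
  have "Cauchy (\<lambda>n. root_sum n x)"
  proof (rule metric_CauchyI)
    fix \<epsilon> :: real assume "\<epsilon> > 0"
    moreover have "(\<lambda>n. s n * norm x) \<longlonglongrightarrow> 0" by (rule tendsto_mult_left_zero[OF s_tendsto_0])
    ultimately have "\<forall>\<^sub>F n in sequentially. s n * norm x < \<epsilon>" by (rule order_tendstoD(2)[rotated])
    then obtain N where N: "\<And>n. n \<ge> N \<Longrightarrow> s n * norm x < \<epsilon>" by (auto simp: eventually_sequentially)
    have "dist (root_sum m x) (root_sum n x) < \<epsilon>" if "m \<ge> N" "n \<ge> N" for m n
    proof (cases m n rule: le_cases)
      case le
      then show ?thesis using norm_root_sum_diff[OF le, of x] N[OF that(1)]
        by (simp add: dist_norm norm_minus_commute)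
    next
      case ge
      then show ?thesis using norm_root_sum_diff[OF ge, of x] N[OF that(2)] by (simp add: dist_norm)
    qed
    then show "\<exists>M. \<forall>m\<ge>M. \<forall>n\<ge>M. dist (root_sum m x) (root_sum n x) < \<epsilon>" by blast
  qed
  then show ?thesis by (simp add: root_op_def Cauchy_convergent_iff convergent_LIMSEQ_iff)
qed

lemma bounded_clinear_root_op: "bounded_clinear root_op"
proof (rule bounded_clinearI)
  show "root_op (x + y) = root_op x + root_op y" for x y
  proof (rule LIMSEQ_unique[OF root_sum_tendsto])
    have "root_sum n (x + y) = root_sum n x + root_sum n y" for n
      by (simp add: root_sum_def cinner_add_left scaleC_add_left distrib_left sum.distrib)
    then show "(\<lambda>n. root_sum n (x + y)) \<longlonglongrightarrow> root_op x + root_op y"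
      using tendsto_add[OF root_sum_tendsto root_sum_tendsto] by simp
  qed
  show "root_op (c *\<^sub>C x) = c *\<^sub>C root_op x" for c x
  proof (rule LIMSEQ_unique[OF root_sum_tendsto])
    have "root_sum n (c *\<^sub>C x) = c *\<^sub>C root_sum n x" for n
      by (simp add: root_sum_def cinner_scaleC_left complex_vector.scale_sum_right scaleC_scaleC mult_ac)
    then show "(\<lambda>n. root_sum n (c *\<^sub>C x)) \<longlonglongrightarrow> c *\<^sub>C root_op x"
      using tendsto_scaleC_right[OF root_sum_tendsto] by simp
  qed
  show "norm (root_op x) \<le> norm x * s 0" for x
    by (rule LIMSEQ_le_const2[OF tendsto_norm[OF root_sum_tendsto]])
      (use norm_root_sum_diff[of 0 _ x] in \<open>simp add: root_sum_def mult.commute\<close>)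
qed

lemma root_op_e: "root_op (e j) = s j *\<^sub>R e j"
proof (rule LIMSEQ_unique[OF root_sum_tendsto], rule tendsto_eventually)
  have "root_sum n (e j) = s j *\<^sub>R e j" if "j < n" for n
  proof -
    have "root_sum n (e j) = (\<Sum>k<n. if k = j then s j *\<^sub>R e j else 0)"
      unfolding root_sum_def
      by (rule sum.cong) (auto simp: cinner_e e_eq_0 scaleR_eq_scaleC)
    then show ?thesis using that by simp
  qed
  then show "\<forall>\<^sub>F n in sequentially. root_sum n (e j) = s j *\<^sub>R e j"
    by (intro eventually_sequentiallyI[of "Suc j"]) auto
qed

text \<open>Both sides are diagonal on the \<open>e k\<close>, hence agree on projections:
  \<open>root_op (root_sum n x)\<close> is \<open>cadjoint T \<circ> T\<close> at
  \<open>expansion n x\<close>. The remainder vanishes in the limit after applying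
  \<open>T\<close>.\<close>

lemma root_op_root_op: "root_op (root_op x) = cadjoint T (T x)"
proof (rule LIMSEQ_unique[OF bounded_clinear_tendsto[OF bounded_clinear_root_op root_sum_tendsto]])
  note T' = bounded_clinear_cadjoint[OF bounded]
  have eq: "root_op (root_sum n x) = cadjoint T (T x) - cadjoint T (T (x - expansion n x))" for n
  proof -
    have "cadjoint T (T (expansion n x)) = root_op (root_sum n x)"
      unfolding expansion_def root_sum_def
        bounded_clinear_sum[OF bounded] bounded_clinear_sum[OF T'] bounded_clinear_sum[OF bounded_clinear_root_op]
      by (rule sum.cong) (simp_all add: eig root_op_e scaleR_eq_scaleC scaleC_scaleC power2_eq_square mult_ac)
    then show ?thesis by (simp add: bounded_clinear_diff[OF bounded] bounded_clinear_diff[OF T'])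
  qed
  have "(\<lambda>n. cadjoint T (T x) - cadjoint T (T (x - expansion n x))) \<longlonglongrightarrow> cadjoint T (T x) - cadjoint T 0"
    by (intro tendsto_intros bounded_clinear_tendsto[OF T'] T_remainder_tendsto_0)
  then show "(\<lambda>n. root_op (root_sum n x)) \<longlonglongrightarrow> cadjoint T (T x)"
    by (simp add: eq bounded_clinear_zero[OF T'])
qed

lemma positive_root_op: "positive_operator root_op"
  unfolding positive_operator_def
proof (intro conjI allI bounded_clinear_root_op)
  fix x
  have "cinner (root_sum n x) x = complex_of_real (\<Sum>k<n. s k * (cmod (cinner x (e k)))\<^sup>2)" for n
    unfolding root_sum_def cinner_sum_left of_real_sum
  proof (rule sum.cong)
    fix k
    show "cinner ((complex_of_real (s k) * cinner x (e k)) *\<^sub>C e k) x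
        = complex_of_real (s k * (cmod (cinner x (e k)))\<^sup>2)"
      using cinner_commute[of "e k" x] by (simp add: cinner_scaleC_left complex_norm_square[symmetric] mult.assoc)
  qed simp
  then have "cinner (root_sum n x) x \<in> \<real>\<^sub>\<ge>\<^sub>0" for n
    by (simp only: nonneg_Reals_of_real_iff) (simp add: sum_nonneg nonneg)
  then show "cinner (root_op x) x \<in> \<real>\<^sub>\<ge>\<^sub>0"
    by (intro closed_sequentially[OF closed_nonneg_Reals_complex _ tendsto_cinner_left[OF root_sum_tendsto]]) auto
qed

text \<open>Any positive square root satisfies \<open>norm (Q y) = norm (T y)\<close>, so
  \<open>Q\<close> also sends the remainders to 0 in the limit. Thus \<open>Q\<close> is determined
  by its values on the \<open>e n\<close>.\<close>

lemma root_op_unique: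
  assumes Q: "positive_operator Q" and QQ: "Q \<circ> Q = cadjoint T \<circ> T"
  shows "Q = root_op"
proof
  fix x
  have bQ: "bounded_clinear Q" using Q by (simp add: positive_operator_def)
  have QQx: "Q (Q x) = cadjoint T (T x)" for x using fun_cong[OF QQ, of x] by simp
  have Qe: "Q (e n) = s n *\<^sub>R e n" for n
  proof (cases "s n = 0")
    case False
    \<comment> \<open>From \<open>Q (Q (e n)) = (s n)\<^sup>2 *\<^sub>R e n\<close>, this vector
      satisfies the eigenvector equation for the negative number \<open>- s n\<close>; positivity of
      \<open>Q\<close> forces it to be 0.\<close>
    define y where "y = Q (e n) - s n *\<^sub>R e n"
    have "Q y = (- complex_of_real (s n)) *\<^sub>C y"
      by (simp add: y_def bounded_clinear_diff[OF bQ] scaleR_eq_scaleC bounded_clinear_scaleC[OF bQ] QQx eig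
          complex_vector.scale_right_diff_distrib scaleC_scaleC power2_eq_square)
    then have "cinner (Q y) y = complex_of_real (- (s n * (norm y)\<^sup>2))"
      by (simp add: cinner_scaleC_left cinner_minus_left cinner_self)
    moreover have "cinner (Q y) y \<in> \<real>\<^sub>\<ge>\<^sub>0" using Q by (simp add: positive_operator_def)
    ultimately have "0 \<le> - (s n * (norm y)\<^sup>2)" by (simp only: nonneg_Reals_of_real_iff)
    then have "y = 0" using nonneg[of n] False by (simp add: mult_le_0_iff)
    then show ?thesis by (simp add: y_def)
  qed (simp add: e_eq_0 bounded_clinear_zero[OF bQ])
  have "Q (expansion n x) = root_sum n x" for n
    unfolding expansion_def root_sum_def bounded_clinear_sum[OF bQ]
    by (rule sum.cong) (simp_all add: Qe scaleR_eq_scaleC scaleC_scaleC mult.commute)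
  then have Qr: "Q x - root_sum n x = Q (x - expansion n x)" for n
    by (simp add: bounded_clinear_diff[OF bQ])
  have "norm (Q y) = norm (T y)" for y
  proof -
    have "complex_of_real ((norm (Q y))\<^sup>2) = complex_of_real ((norm (T y))\<^sup>2)"
      by (simp add: cinner_self[symmetric] positive_operator_cinner[OF Q] QQx cinner_cadjoint[OF bounded] del: of_real_power)
    then have "(norm (Q y))\<^sup>2 = (norm (T y))\<^sup>2" unfolding of_real_eq_iff .
    then show ?thesis by (simp add: power2_eq_iff_nonneg)
  qed
  then have "(\<lambda>n. norm (Q x - root_sum n x)) \<longlonglongrightarrow> 0"
    using tendsto_norm_zero[OF T_remainder_tendsto_0[of x]] by (simp only: Qr)
  then have "(\<lambda>n. Q x - root_sum n x) \<longlonglongrightarrow> 0" by (rule tendsto_norm_zero_cancel)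
  then have "(\<lambda>n. Q x - (Q x - root_sum n x)) \<longlonglongrightarrow> Q x - 0" by (intro tendsto_intros)
  then show "Q x = root_op x" using LIMSEQ_unique[OF root_sum_tendsto] by simp
qed

lemma abs_operator_eq: "abs_operator T = root_op"
  unfolding abs_operator_def
  by (rule the_equality) (auto simp: positive_root_op root_op_root_op intro: root_op_unique)

section \<open>Multiplicities of the positive eigenvalues\<close>

lemma finite_level: "0 < r \<Longrightarrow> finite {n. s n = r}"
proof -
  assume "0 < r"
  then have "\<forall>\<^sub>F n in sequentially. s n < r" using order_tendstoD(2)[OF s_tendsto_0] by blast
  then obtain N where "\<And>n. n \<ge> N \<Longrightarrow> s n < r" by (auto simp: eventually_sequentially)
  then have "{n. s n = r} \<subseteq> {..<N}" by (force simp: not_le[symmetric])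
  then show ?thesis by (rule finite_subset) simp
qed

text \<open>An eigenvector for \<open>r\<close> is orthogonal to each \<open>e n\<close> with
  \<open>s n \<noteq> r\<close>, since \<open>root_op\<close> is symmetric. Projecting past all of
  the finitely many indices at level \<open>r\<close> leaves an eigenvector \<open>y\<close>
  orthogonal to every \<open>e k\<close>; so \<open>root_op y = 0\<close>, and \<open>r > 0\<close>
  gives \<open>y = 0\<close>.\<close>

lemma eigenspace_eq_span:
  assumes r: "0 < r"
  shows "eigenspace root_op (complex_of_real r) = complex_vector.span (e ` {n. s n = r})"
proof (intro equalityI subsetI)
  fix x assume "x \<in> eigenspace root_op (complex_of_real r)"
  then have x: "root_op x = complex_of_real r *\<^sub>C x" by (simp add: eigenspace_def)
  have orthx: "cinner x (e n) = 0" if "s n \<noteq> r" for n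
  proof -
    have "complex_of_real r * cinner x (e n) = cinner (root_op x) (e n)"
      by (simp add: x cinner_scaleC_left)
    also have "\<dots> = complex_of_real (s n) * cinner x (e n)"
      by (simp add: positive_operator_cinner[OF positive_root_op] root_op_e cinner_scaleR_right)
    finally show ?thesis using that by simp
  qed
  obtain N where N: "\<And>n. s n = r \<Longrightarrow> n < N"
    using finite_level[OF r] finite_nat_set_iff_bounded[of "{n. s n = r}"] by auto
  define y where "y = x - expansion N x"
  have ex: "expansion N x \<in> complex_vector.span (e ` {n. s n = r})"
    unfolding expansion_def
  proof (rule complex_vector.span_sum)
    fix k
    show "cinner x (e k) *\<^sub>C e k \<in> complex_vector.span (e ` {n. s n = r})"
    proof (cases "s k = r")
      case True
      then have "e k \<in> complex_vector.span (e ` {n. s n = r})"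
        by (intro complex_vector.span_base) simp
      then show ?thesis by (rule complex_vector.span_scale)
    qed (simp add: orthx complex_vector.span_zero)
  qed
  have "cinner x (e k) *\<^sub>C root_op (e k) = complex_of_real r *\<^sub>C (cinner x (e k) *\<^sub>C e k)" for k
    by (cases "s k = r") (simp_all add: root_op_e scaleR_eq_scaleC scaleC_scaleC mult.commute orthx)
  then have "root_op (expansion N x) = complex_of_real r *\<^sub>C expansion N x"
    by (simp add: expansion_def bounded_clinear_sum[OF bounded_clinear_root_op] complex_vector.scale_sum_right)
  then have ry: "root_op y = complex_of_real r *\<^sub>C y"
    by (simp add: y_def x bounded_clinear_diff[OF bounded_clinear_root_op] complex_vector.scale_right_diff_distrib)
  have "cinner y (e k) = 0" for k
  proof (cases "k < N")
    case True
    then show ?thesis by (simp add: y_def cinner_remainder)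
  next
    case False
    then have "s k \<noteq> r" using N by auto
    have "complex_of_real r * cinner y (e k) = cinner (root_op y) (e k)"
      by (simp add: ry cinner_scaleC_left)
    also have "\<dots> = complex_of_real (s k) * cinner y (e k)"
      by (simp add: positive_operator_cinner[OF positive_root_op] root_op_e cinner_scaleR_right)
    finally show ?thesis using \<open>s k \<noteq> r\<close> by simp
  qed
  then have "root_sum n y = 0" for n by (simp add: root_sum_def)
  then have "root_op y = 0" using root_sum_tendsto[of y] by (simp add: LIMSEQ_const_iff)
  then have "y = 0" using ry r by simp
  then show "x \<in> complex_vector.span (e ` {n. s n = r})" using ex by (simp add: y_def)
next
  fix x assume "x \<in> complex_vector.span (e ` {n. s n = r})"
  then show "x \<in> eigenspace root_op (complex_of_real r)"
  proof (induction rule: complex_vector.span_induct)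
    case base
    show ?case
      unfolding complex_vector.subspace_def eigenspace_def
      by (auto simp: bounded_clinear_zero[OF bounded_clinear_root_op] bounded_clinear_add[OF bounded_clinear_root_op]
         bounded_clinear_scaleC[OF bounded_clinear_root_op] complex_vector.scale_right_distrib complex_vector.scale_left_commute)
  qed (auto simp: eigenspace_def root_op_e scaleR_eq_scaleC)
qed

lemma dim_eigenspace:
  assumes r: "0 < r"
  shows "complex_vector.dim (eigenspace root_op (complex_of_real r)) = card {n. s n = r}"
proof -
  let ?I = "{n. s n = r}"
  have e1: "cinner (e i) (e j) = (if i = j then 1 else 0)" if "i \<in> ?I" for i j
    using that r by (simp add: cinner_e)
  have inj: "inj_on e ?I"
  proof (rule inj_onI)
    fix i j assume "i \<in> ?I" "j \<in> ?I" "e i = e j"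
    then show "i = j" using e1[of i i] e1[of i j] by (simp split: if_splits)
  qed
  have "complex_vector.independent (e ` ?I)"
    unfolding complex_vector.dependent_finite[OF finite_imageI[OF finite_level[OF r]]]
  proof
    assume "\<exists>u. (\<exists>v\<in>e ` ?I. u v \<noteq> 0) \<and> (\<Sum>v\<in>e ` ?I. u v *\<^sub>C v) = 0"
    then obtain u i where u: "(\<Sum>v\<in>e ` ?I. u v *\<^sub>C v) = 0" and i: "u (e i) \<noteq> 0" "s i = r"
      by blast
    have "cinner (\<Sum>v\<in>e ` ?I. u v *\<^sub>C v) (e i) = (\<Sum>k\<in>?I. if k = i then u (e k) else 0)"
      unfolding cinner_sum_left sum.reindex[OF inj] comp_def
      by (rule sum.cong) (auto simp: cinner_scaleC_left e1)
    also have "\<dots> = u (e i)" using i finite_level[OF r] by simp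
    finally show False using u i by simp
  qed
  then show ?thesis
    using inj by (simp add: eigenspace_eq_span[OF r] complex_vector.dim_eq_card_independent card_image)
qed

text \<open>This discharges the definite description: any singular system computes the singular
  values. Uniqueness is \<open>level_card_imp_le\<close> applied in both directions.\<close>

lemma singular_value_seq_eq: "singular_value_seq T = s"
  unfolding singular_value_seq_def
proof (rule the_equality)
  have s: "decseq s" using s_antimono by (simp add: decseq_def)
  show *: "decseq s \<and> (\<forall>n. 0 \<le> s n) \<and> (\<forall>r>0. finite {n. s n = r} \<and>
      card {n. s n = r} = complex_vector.dim (eigenspace (abs_operator T) (complex_of_real r)))"
    using s nonneg finite_level by (simp add: abs_operator_eq dim_eigenspace)
  fix t :: "nat \<Rightarrow> real"
  assume t: "decseq t \<and> (\<forall>n. 0 \<le> t n) \<and> (\<forall>r>0. finite {n. t n = r} \<and>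
      card {n. t n = r} = complex_vector.dim (eigenspace (abs_operator T) (complex_of_real r)))"
  have ds: "decseq t" and t0: "0 \<le> t n" for n using t by blast+
  have card: "finite {n. s n = r} \<and> finite {n. t n = r} \<and> card {n. s n = r} = card {n. t n = r}"
    if "r > 0" for r
    using * t that by simp
  have "s n \<le> t n" for n using level_card_imp_le[OF s ds t0] card by blast
  moreover have "t n \<le> s n" for n using level_card_imp_le[OF ds s nonneg] card by metis
  ultimately show "t = s" by (intro ext antisym)
qed

end

subsection \<open>Minimax comparison\<close>

text \<open>Gaussian elimination: a pivot unknown \<open>p\<close> of the last equation is
  eliminated from the others, leaving one equation and one unknown fewer.\<close>

lemma underdetermined_system:
  fixes M :: "nat \<Rightarrow> 'i \<Rightarrow> complex"
  assumes "finite K" "n < card K"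
  shows "\<exists>c. (\<exists>k\<in>K. c k \<noteq> 0) \<and> (\<forall>i<n. (\<Sum>k\<in>K. c k * M i k) = 0)"
  using assms
proof (induction n arbitrary: K M)
  case 0
  then have "\<exists>k\<in>K. (1::complex) \<noteq> 0" by (auto simp: card_gt_0_iff)
  then show ?case by (intro exI[of _ "\<lambda>_. 1"]) auto
next
  case (Suc n)
  show ?case
  proof (cases "\<forall>k\<in>K. M n k = 0")
    case True
    obtain c where "\<exists>k\<in>K. c k \<noteq> 0" "\<forall>i<n. (\<Sum>k\<in>K. c k * M i k) = 0"
      using Suc.IH[of K M] Suc.prems by auto
    with True show ?thesis by (auto simp: less_Suc_eq)
  next
    case False
    then obtain p where p: "p \<in> K" "M n p \<noteq> 0" by blast
    define K' where "K' = K - {p}"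
    have K': "finite K'" "n < card K'" "p \<notin> K'" and K: "K = insert p K'"
      using Suc.prems p by (auto simp: K'_def)
    obtain c where c: "\<exists>k\<in>K'. c k \<noteq> 0"
      "\<forall>i<n. (\<Sum>k\<in>K'. c k * (M i k - M i p * (M n k / M n p))) = 0"
      using Suc.IH[OF K'(1,2), of "\<lambda>i k. M i k - M i p * (M n k / M n p)"] by blast
    \<comment> \<open>The value of the pivot unknown that solves equation \<open>n\<close>.
      Substituting it turns each equation \<open>i\<close> into its reduced form, whose coefficients
      all vanish when \<open>i = n\<close>.\<close>
    define q where "q = - (\<Sum>k\<in>K'. c k * (M n k / M n p))"
    have eq: "(\<Sum>k\<in>K. (c(p := q)) k * M i k) = (\<Sum>k\<in>K'. c k * (M i k - M i p * (M n k / M n p)))" for i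
    proof -
      have "(\<Sum>k\<in>K'. (c(p := q)) k * M i k) = (\<Sum>k\<in>K'. c k * M i k)"
        using K'(3) by (intro sum.cong) auto
      then show ?thesis
        using K' by (simp add: K q_def sum_distrib_left sum_distrib_right sum_subtractf right_diff_distrib mult_ac)
    qed
    have "(\<Sum>k\<in>K. (c(p := q)) k * M n k) = 0" unfolding eq using p by (simp add: sum.neutral)
    then have "\<forall>i<Suc n. (\<Sum>k\<in>K. (c(p := q)) k * M i k) = 0"
      using c(2) eq by (simp only: less_Suc_eq) blast
    moreover have "\<exists>k\<in>K. (c(p := q)) k \<noteq> 0" using c(1) K'(3) by (auto simp: K)
    ultimately show ?thesis by blast
  qed
qed

text \<open>With more vectors than constraints, some nonzero combination \<open>x\<close> of the
  \<open>g k\<close> meets all of them. Pythagoras applies to \<open>x\<close> and to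
  \<open>T x\<close>, so if every image were longer than \<open>c\<close>, then
  \<open>norm (T x)\<close> would exceed \<open>c * norm x\<close>.\<close>

lemma exists_image_norm_le:
  fixes T :: "'a::complex_inner \<Rightarrow> 'b::complex_inner"
  assumes T: "bounded_clinear T"
    and bound: "\<And>x. (\<And>i. i < n \<Longrightarrow> cinner x (y i) = 0) \<Longrightarrow> norm (T x) \<le> c * norm x"
    and K: "finite K" "n < card K"
    and g: "\<And>k. k \<in> K \<Longrightarrow> norm (g k) = 1"
      "\<And>i j. i \<in> K \<Longrightarrow> j \<in> K \<Longrightarrow> i \<noteq> j \<Longrightarrow> cinner (g i) (g j) = 0"
      "\<And>i j. i \<in> K \<Longrightarrow> j \<in> K \<Longrightarrow> i \<noteq> j \<Longrightarrow> cinner (T (g i)) (T (g j)) = 0"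
  shows "\<exists>k\<in>K. norm (T (g k)) \<le> c"
proof (rule ccontr)
  assume "\<not> (\<exists>k\<in>K. norm (T (g k)) \<le> c)"
  then have big: "c < norm (T (g k))" if "k \<in> K" for k using that by force
  obtain a where a: "\<exists>k\<in>K. a k \<noteq> 0" "\<And>i. i < n \<Longrightarrow> (\<Sum>k\<in>K. a k * cinner (g k) (y i)) = 0"
    using underdetermined_system[OF K, of "\<lambda>i k. cinner (g k) (y i)"] by blast
  define x where "x = (\<Sum>k\<in>K. a k *\<^sub>C g k)"
  have nx: "(norm x)\<^sup>2 = (\<Sum>k\<in>K. (cmod (a k))\<^sup>2)"
    unfolding x_def by (subst norm_sum_orthogonal_sq) (use K g in auto)
  have nTx: "(norm (T x))\<^sup>2 = (\<Sum>k\<in>K. (cmod (a k))\<^sup>2 * (norm (T (g k)))\<^sup>2)"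
    unfolding x_def bounded_clinear_sum[OF T] by (rule norm_sum_orthogonal_sq) (use K g in auto)
  have le: "norm (T x) \<le> c * norm x"
    by (rule bound) (simp add: x_def cinner_sum_left cinner_scaleC_left a)
  obtain p where p: "p \<in> K" "a p \<noteq> 0" using a by blast
  have "0 < (norm x)\<^sup>2" unfolding nx by (rule sum_pos2[OF K(1) p(1)]) (use p in auto)
  then have "0 < norm x" by simp
  \<comment> \<open>The sign of \<open>c\<close> follows from the bound at the nonzero vector
    \<open>x\<close>; it allows the inequalities to be squared.\<close>
  then have c0: "0 \<le> c" using order_trans[OF norm_ge_zero le] by (simp add: zero_le_mult_iff)
  have sq: "c\<^sup>2 < (norm (T (g k)))\<^sup>2" if "k \<in> K" for k
    using big[OF that] c0 by (intro power_strict_mono) auto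
  have "(c * norm x)\<^sup>2 = (\<Sum>k\<in>K. (cmod (a k))\<^sup>2 * c\<^sup>2)"
    by (simp add: power_mult_distrib nx sum_distrib_left mult.commute)
  also have "\<dots> < (norm (T x))\<^sup>2"
    unfolding nTx
  proof (rule sum_strict_mono_ex1[OF K(1)])
    show "\<forall>k\<in>K. (cmod (a k))\<^sup>2 * c\<^sup>2 \<le> (cmod (a k))\<^sup>2 * (norm (T (g k)))\<^sup>2"
      using sq by (intro ballI mult_left_mono) (auto intro: less_imp_le)
    show "\<exists>k\<in>K. (cmod (a k))\<^sup>2 * c\<^sup>2 < (cmod (a k))\<^sup>2 * (norm (T (g k)))\<^sup>2"
      using p sq by (intro bexI[of _ p] mult_strict_left_mono) auto
  qed
  finally show False using power_mono[OF le norm_ge_zero, of 2] by simp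
qed

text \<open>One half of the minimax principle, tested on the \<open>n + 1\<close> vectors
  \<open>e 0\<close> to \<open>e n\<close>.\<close>

lemma (in singular_system) s_le:
  assumes c: "0 \<le> c" and le: "\<And>x. (\<And>i. i < n \<Longrightarrow> cinner x (y i) = 0) \<Longrightarrow> norm (T x) \<le> c * norm x"
  shows "s n \<le> c"
proof (rule ccontr)
  assume "\<not> s n \<le> c"
  then have big: "c < s k" if "k \<le> n" for k using s_antimono[OF that] by simp
  have "\<exists>k\<in>{..n}. norm (T (e k)) \<le> c"
  proof (rule exists_image_norm_le[OF bounded le])
    show "n < card {..n}" unfolding card_atMost by (rule lessI)
    \<comment> \<open>Here \<open>0 \<le> c < s k\<close> excludes the zero vectors used as
      padding.\<close>
    show "norm (e k) = 1" if "k \<in> {..n}" for k using norm_e[of k] big[of k] c that by simp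
  qed (simp_all add: orth cinner_T_e)
  then show False using big by (auto simp: norm_T_e not_le[symmetric])
qed

subsection \<open>Compactness of products and direct sums\<close>

lemma compact_closure_subset:
  fixes S :: "'a::t2_space set"
  assumes "compact C" "S \<subseteq> C"
  shows "compact (closure S)"
proof -
  have "closure S \<subseteq> C" by (rule closure_minimal[OF assms(2) compact_imp_closed[OF assms(1)]])
  then show ?thesis using compact_Int_closed[OF assms(1) closed_closure, of S] by (simp add: Int_absorb1)
qed

text \<open>\<open>R\<close> maps the unit ball into a ball of radius \<open>K\<close>, so the image
  under \<open>S \<circ> R\<close> lies in the \<open>K\<close>-multiple of a compact set.\<close>

lemma compact_operator_comp:
  fixes S :: "'b::complex_inner \<Rightarrow> 'c::complex_inner" and R :: "'a::complex_inner \<Rightarrow> 'b"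
  assumes S: "compact_operator S" and R: "bounded_clinear R"
  shows "compact_operator (S \<circ> R)"
  unfolding compact_operator_def
proof
  note bS = compact_operator_imp_bounded_clinear[OF S]
  show "bounded_clinear (S \<circ> R)" by (rule bounded_clinear_comp[OF bS R])
  obtain K where K: "\<And>x. norm (R x) \<le> norm x * K" and K0: "0 < K"
    using bounded_linear.pos_bounded[OF bounded_clinear_imp_bounded_linear[OF R]] by blast
  have "compact ((*\<^sub>R) K ` closure (S ` cball 0 1))"
    using S by (intro compact_scaling) (simp add: compact_operator_def)
  moreover have "(S \<circ> R) ` cball 0 1 \<subseteq> (*\<^sub>R) K ` closure (S ` cball 0 1)"
  proof safe
    fix x :: 'a assume x: "x \<in> cball 0 1"
    define z where "z = (1 / K) *\<^sub>R R x"
    have "norm x * K \<le> 1 * K" using x K0 by (intro mult_right_mono) auto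
    then have "norm (R x) \<le> K" using K[of x] by simp
    then have "z \<in> cball 0 1" using K0 by (simp add: z_def divide_le_eq)
    then have "S z \<in> closure (S ` cball 0 1)" by (intro subsetD[OF closure_subset] imageI)
    moreover have "(S \<circ> R) x = K *\<^sub>R S z"
      using K0 by (simp add: z_def linear_simps[OF bounded_clinear_imp_bounded_linear[OF bS]])
    ultimately show "(S \<circ> R) x \<in> (*\<^sub>R) K ` closure (S ` cball 0 1)" by blast
  qed
  ultimately show "compact (closure ((S \<circ> R) ` cball 0 1))" by (rule compact_closure_subset)
qed

lemma compact_operator_map_prod:
  assumes A: "compact_operator A" and B: "compact_operator B"
  shows "compact_operator (map_prod A B)"
  unfolding compact_operator_def
proof
  note bA = compact_operator_imp_bounded_clinear[OF A] and bB = compact_operator_imp_bounded_clinear[OF B]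
  have "bounded_linear (\<lambda>p. (A (fst p), B (snd p)))"
    by (intro bounded_linear_Pair bounded_linear_compose[OF bounded_clinear_imp_bounded_linear[OF bA]]
        bounded_linear_compose[OF bounded_clinear_imp_bounded_linear[OF bB]] bounded_linear_fst bounded_linear_snd)
  moreover have "map_prod A B = (\<lambda>p. (A (fst p), B (snd p)))" by (auto simp: fun_eq_iff)
  ultimately show "bounded_clinear (map_prod A B)"
    by (simp add: bounded_clinear_def scaleC_prod_def bounded_clinear_scaleC[OF bA] bounded_clinear_scaleC[OF bB])
  have "compact (closure (A ` cball 0 1) \<times> closure (B ` cball 0 1))"
    using A B by (intro compact_Times) (simp_all add: compact_operator_def)
  moreover have "map_prod A B ` cball 0 1 \<subseteq> closure (A ` cball 0 1) \<times> closure (B ` cball 0 1)"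
  proof
    fix q assume "q \<in> map_prod A B ` cball 0 1"
    then obtain x y where q: "q = (A x, B y)" and xy: "norm (x, y) \<le> 1" by auto
    have "x \<in> cball 0 1" "y \<in> cball 0 1"
      using norm_fst_le[of x y] norm_snd_le[of y x] xy by auto
    then show "q \<in> closure (A ` cball 0 1) \<times> closure (B ` cball 0 1)"
      unfolding q by (intro SigmaI subsetD[OF closure_subset] imageI)
  qed
  ultimately show "compact (closure (map_prod A B ` cball 0 1))" by (rule compact_closure_subset)
qed

subsection \<open>Singular values of direct sums and products\<close>

text \<open>If no split existed, \<open>a\<close> vectors \<open>(e k, 0)\<close> and
  \<open>n + 1 - a\<close> vectors \<open>(0, f k)\<close> would form an orthonormal family of size
  \<open>n + 1\<close> with orthogonal images longer than \<open>w n\<close>. This contradicts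
  \<open>exists_image_norm_le\<close>, since \<open>bound\<close> for the direct sum imposes only
  \<open>n\<close> constraints.\<close>

lemma singular_values_direct_sum_split:
  assumes A: "singular_system A e s" and B: "singular_system B f t"
    and C: "singular_system (map_prod A B) h w"
  shows "\<exists>a b. a + b = n \<and> s a \<le> w n \<and> t b \<le> w n"
proof (rule ccontr)
  interpret A: singular_system A e s by (rule A)
  interpret B: singular_system B f t by (rule B)
  interpret C: singular_system "map_prod A B" h w by (rule C)
  assume neg: "\<not> ?thesis"
  have no: "w n < t b" if "a + b = n" "s a \<le> w n" for a b
  proof (rule ccontr)
    assume "\<not> w n < t b"
    then have "t b \<le> w n" by simp
    with neg that show False by blast
  qed
  \<comment> \<open>The number of leading \<open>s k\<close> above \<open>w n\<close>, capped at
    \<open>n + 1\<close>. The cap provides a witness for \<open>LEAST\<close> and keeps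
    \<open>Suc n - a\<close> a genuine subtraction.\<close>
  define a where "a = (LEAST a. a = Suc n \<or> s a \<le> w n)"
  have a: "a = Suc n \<or> s a \<le> w n" unfolding a_def by (rule LeastI[of _ "Suc n"]) simp
  have an: "a \<le> Suc n" unfolding a_def by (rule Least_le) simp
  have sk: "w n < s k" if "k < a" for k
    using not_less_Least[of k "\<lambda>a. a = Suc n \<or> s a \<le> w n"] that by (simp add: a_def)
  \<comment> \<open>Such a \<open>k\<close> exists only if \<open>a \<le> n\<close>; then
    \<open>s a \<le> w n\<close>, so the assumed failure of the split \<open>a + (n - a)\<close>
    makes \<open>t (n - a)\<close> large, and earlier entries are no smaller.\<close>
  have tk: "w n < t k" if "k < Suc n - a" for k
  proof -
    have "w n < t (n - a)" using no[of a "n - a"] a an that by auto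
    also have "\<dots> \<le> t k" using that by (intro B.s_antimono) auto
    finally show ?thesis .
  qed
  define K where "K = {..<a} <+> {..<Suc n - a}"
  define g where "g = case_sum (\<lambda>k. (e k, 0)) (\<lambda>k. (0, f k))"
  note zero = bounded_clinear_zero[OF A.bounded] bounded_clinear_zero[OF B.bounded]
  have "\<exists>k\<in>K. norm (map_prod A B (g k)) \<le> w n"
  proof (rule exists_image_norm_le[OF C.bounded C.bound])
    show "finite K" by (simp add: K_def)
    show "n < card K" using an by (simp add: K_def card_Plus)
    show "norm (g k) = 1" if "k \<in> K" for k
    proof (cases k)
      case (Inl i)
      then have "w n < s i" using that by (intro sk) (auto simp: K_def)
      then show ?thesis using Inl A.norm_e[of i] C.nonneg[of n] by (simp add: g_def norm_Pair)
    next
      case (Inr i)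
      then have "w n < t i" using that by (intro tk) (auto simp: K_def)
      then show ?thesis using Inr B.norm_e[of i] C.nonneg[of n] by (simp add: g_def norm_Pair)
    qed
    show "cinner (g i) (g j) = 0" if "i \<noteq> j" for i j
      using that by (cases i; cases j) (auto simp: g_def cinner_prod_def A.orth B.orth)
    show "cinner (map_prod A B (g i)) (map_prod A B (g j)) = 0" if "i \<noteq> j" for i j
      using that by (cases i; cases j) (auto simp: g_def cinner_prod_def A.cinner_T_e B.cinner_T_e zero)
  qed
  then obtain k where k: "k \<in> K" "norm (map_prod A B (g k)) \<le> w n" by blast
  show False
  proof (cases k)
    case (Inl i)
    then show False using k sk[of i] by (auto simp: K_def g_def norm_Pair zero A.norm_T_e)
  next
    case (Inr i)
    then show False using k tk[of i] by (auto simp: K_def g_def norm_Pair zero B.norm_T_e)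
  qed
qed

text \<open>By \<open>s_le\<close> it suffices to bound the product operator under
  \<open>a + b\<close> orthogonality constraints. With \<open>u = cadjoint B x\<close>,
  \<open>b\<close> of them make \<open>u\<close> orthogonal to the first \<open>f i\<close>, and
  \<open>a\<close> of them make \<open>X u\<close> orthogonal to the first
  \<open>e i\<close>.\<close>

lemma singular_value_product_le:
  assumes A: "singular_system A e s" and B: "singular_system B f t" and X: "bounded_clinear X"
    and D: "singular_system (A \<circ> X \<circ> cadjoint B) h w"
  shows "w (a + b) \<le> s a * (onorm X * t b)"
proof -
  interpret A: singular_system A e s by (rule A)
  interpret B: singular_system B f t by (rule B)
  interpret D: singular_system "A \<circ> X \<circ> cadjoint B" h w by (rule D)
  \<comment> \<open>The constraints on \<open>X u\<close> and on \<open>u\<close>, pulled back to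
    \<open>x\<close> through the adjoints.\<close>
  define y where "y i = (if i < a then B (cadjoint X (e i)) else B (f (i - a)))" for i
  have X0: "0 \<le> onorm X" by (rule onorm_pos_le[OF bounded_clinear_imp_bounded_linear[OF X]])
  show ?thesis
  proof (rule D.s_le[where y = y])
    show "0 \<le> s a * (onorm X * t b)" by (intro mult_nonneg_nonneg A.nonneg B.nonneg X0)
    fix x assume x: "\<And>i. i < a + b \<Longrightarrow> cinner x (y i) = 0"
    let ?u = "cadjoint B x"
    have "cinner ?u (f i) = 0" if "i < b" for i
      using x[of "a + i"] that by (simp add: y_def cinner_cadjoint_left[OF B.bounded])
    then have Bu: "norm (B ?u) \<le> t b * norm ?u" by (rule B.bound)
    \<comment> \<open>The bound for \<open>B\<close> at \<open>u\<close> passes to the adjoint: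
      \<open>(norm ?u)\<^sup>2\<close> is the modulus of \<open>cinner (B ?u) x\<close>, hence at
      most \<open>t b * norm ?u * norm x\<close>.\<close>
    have u: "norm ?u \<le> t b * norm x"
    proof (cases "norm ?u = 0")
      case False
      have "norm ?u * norm ?u = cmod (cinner (B ?u) x)"
        by (simp add: cinner_cadjoint[OF B.bounded] cinner_self norm_power power2_eq_square norm_mult)
      also have "\<dots> \<le> norm (B ?u) * norm x" by (rule norm_cinner_le)
      also have "\<dots> \<le> t b * norm ?u * norm x" by (intro mult_right_mono Bu) auto
      finally have "norm ?u * norm ?u \<le> norm ?u * (t b * norm x)" by (simp add: mult_ac)
      then show ?thesis using False by (subst (asm) mult_le_cancel_left_pos) auto
    qed (use B.nonneg in simp)
    have "cinner (X ?u) (e i) = 0" if "i < a" for i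
      using x[of i] that by (simp add: y_def cinner_cadjoint_left[OF B.bounded] cinner_cadjoint[OF X])
    then have "norm (A (X ?u)) \<le> s a * norm (X ?u)" by (rule A.bound)
    also have "\<dots> \<le> s a * (onorm X * norm ?u)"
      by (intro mult_left_mono onorm bounded_clinear_imp_bounded_linear[OF X] A.nonneg)
    also have "\<dots> \<le> s a * (onorm X * (t b * norm x))"
      by (intro mult_left_mono u A.nonneg X0)
    finally show "norm ((A \<circ> X \<circ> cadjoint B) x) \<le> s a * (onorm X * t b) * norm x"
      by (simp add: mult.assoc)
  qed
qed

theorem theorem2p8:
  fixes A B X :: "'h::complex_hilbert \<Rightarrow> 'h" and j :: nat
  assumes separable: "separable_space (euclidean :: 'h topology)"
    and A: "compact_operator A"
    and B: "compact_operator B"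
    and X: "bounded_clinear X"
    and j: "j \<ge> 1"
  shows "singular_value j (A \<circ> X \<circ> cadjoint B)
           \<le> onorm X * (singular_value j (map_prod A B))\<^sup>2"
proof -
  have B': "bounded_clinear (cadjoint B)"
    by (rule bounded_clinear_cadjoint[OF compact_operator_imp_bounded_clinear[OF B]])
  obtain e s where A_sys: "singular_system A e s" by (rule singular_system_exists[OF A])
  obtain f t where B_sys: "singular_system B f t" by (rule singular_system_exists[OF B])
  obtain g v where C_sys: "singular_system (map_prod A B) g v"
    by (rule singular_system_exists[OF compact_operator_map_prod[OF A B]])
  obtain h w where D_sys: "singular_system (A \<circ> X \<circ> cadjoint B) h w"
    by (rule singular_system_exists[OF compact_operator_comp[OF compact_operator_comp[OF A X] B']])
  \<comment> \<open>The \<open>j\<close>-th singular value is entry \<open>j - 1\<close> of the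
    sequence counted from 0. Each of the two factors is at most \<open>v (j - 1)\<close>, which
    produces the square.\<close>
  obtain a b where ab: "a + b = j - 1" "s a \<le> v (j - 1)" "t b \<le> v (j - 1)"
    using singular_values_direct_sum_split[OF A_sys B_sys C_sys] by blast
  have X0: "0 \<le> onorm X" by (rule onorm_pos_le[OF bounded_clinear_imp_bounded_linear[OF X]])
  have "w (j - 1) \<le> s a * (onorm X * t b)"
    using singular_value_product_le[OF A_sys B_sys X D_sys, of a b] ab(1) by simp
  also have "\<dots> = onorm X * (s a * t b)" by simp
  also have "\<dots> \<le> onorm X * (v (j - 1) * v (j - 1))"
    by (intro mult_left_mono mult_mono ab X0 singular_system.nonneg[OF B_sys] singular_system.nonneg[OF C_sys])
  finally show ?thesis
    by (simp add: singular_value_def singular_system.singular_value_seq_eq[OF C_sys]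
        singular_system.singular_value_seq_eq[OF D_sys] power2_eq_square)
qed

end
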